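(* For any robustly feasible PPM problem, FFRob has a finite expected runtime and finite variance in runtime: if $T$ denotes the (random) number of time steps before FFRob halts and returns a solution, then $\mathbb{E}[T]<\infty$ and $\mathrm{Var}(T)<\infty$.
   Context: **PPM domain.** There are $m$ movable rigid objects $o_1,\dots,o_m$; a robot configuration space $\mathcal{Q}\subseteq\mathbb{R}^d$ (configurations free of collisions with fixed obstacles and of self-collisions); for each $i$ a space $\mathcal{P}^{o_i}$ of legal placement poses of $o_i$ (rigid transforms) and a space $\mathcal{G}^{o_i}$ of grasps $g=(o_i,\gamma)$, where $\gamma=\mathrm{transform}(g)$ is a rigid transform. A map $\mathrm{ee}$ sends $q\in\mathcal{Q}$ to the end-effector transform; if the robot at $q$ holds $o_i$ with grasp $g$, the object is at pose $\mathrm{ee}(q)\times\mathrm{transform}(g)$. Robot and object geometries determine which bodies collide. A state is $s=(q,g,p^{o_1},\dots,p^{o_m})$ with $q\in D_r=\mathcal{Q}$, $g\in D_h=\bigcup_i\mathcal{G}^{o_i}\cup\{\mathrm{None}\}$, $p^{o_i}\in D_{o_i}=\mathcal{P}^{o_i}\cup\{\mathrm{None}\}$; the robot holds at most one object, and $p^{o_i}=\mathrm{None}$ exactly when $o_i$ is held. A state is legal if there are no collisions among the robot, the held object and the placed objects. **PPM problem.** $\Pi=\langle s_0,S_*\rangle$ with $s_0=(q_0,g_0,p_0^{o_1},\dots,p_0^{o_m})$ legal and $S_*$ the set of legal states in $Q_*\times G_*\times P_*^{o_1}\times\cdots\times P_*^{o_m}$, where $Q_*\subseteq D_r$, $G_*\subseteq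 D_h$, $P_*^{o_i}\subseteq D_{o_i}$ (an unspecified goal set is the full domain). $o_{h_*}$ denotes the object, if any, with $G_*\subseteq\mathcal{G}^{o_{h_*}}$. **Measures.** Each space $X$ below that is sampled (with $\mathrm{None}$ removed) carries a measure $\mu(\cdot;X)$ with $0<\mu(X;X)<\infty$ (Lebesgue measure for $X=\mathcal{Q}$); $\tilde\mu(E;X)=\mu(E;X)/\mu(X;X)$. All sets below are assumed measurable. $x\sim X$ means $\Pr[x\in E]=\tilde\mu(E;X)$. For a transform $t$, $Q_{ik}(t)=\{q\in\mathcal{Q}:\mathrm{ee}(q)=t\}$. There is $\kappa>0$ such that inverse-kinematics samples $q$ from any nonempty $Q_{ik}(t)$ satisfy $\Pr[q\in E]\ge\kappa\,\tilde\mu(E;Q_{ik}(t))$. **Modes.** A transit mode $\psi=\langle\mathrm{None},\{p^{o_j}\}_{j\in[m]}\rangle$ fixes a pose $p^{o_j}\in\mathcal{P}^{o_j}$ for every object. A transfer mode $\phi=\langle g^{o_h},\{p^{o_j}\}_{j\ne h}\rangle$ fixes a grasp of one object $o_h$ and poses of all others. A mode is legal if the placed objects do not collide with each other. $Q_\psi\subseteq\mathcal{Q}$ is the set of configurations at which the robot does not collide with the placed objects; $Q_\phi\subseteq\mathcal{Q}$ is the set at which neither the robot nor the held object collides with the placed objects, and the held object does not intersect the robot. For a transit mode $\psi$ and a transfer mode $\phi$ holding $o_h$, let $t(\psi,\phi)=t(\phi,\psi)=p_\psi^{o_h}\times\mathrm{transform}(g_\phi^{o_h})^{-1}$; $\psi,\phi$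 are adjacent if the poses of all objects other than $o_h$ agree in both and $Q_\psi\cap Q_\phi\cap Q_{ik}(t(\psi,\phi))\neq\emptyset$. A mode sequence is a sequence $(\omega_1,\dots,\omega_k)$ of legal modes, consecutive ones adjacent (hence alternating between transit and transfer). **Robust motion planning.** A motion planning problem in $Q\subseteq\mathbb{R}^d$ from $q^0\in Q$ to $q^*\in Q$ is robustly feasible if there are $\delta>0$ and a finite-length trajectory $\tau$ in $Q$ from some $q^0_+$ to some $q^*_+$ such that every point of $\tau$ is at distance $\ge\delta$ from $\partial Q$, the segment from $q^0$ to $q$ lies in $Q$ for every $q\in Q$ with $\|q-q^0_+\|\le\delta/2$, and the segment from $q'$ to $q^*$ lies in $Q$ for every $q'\in Q$ with $\|q'-q^*_+\|\le\delta/2$. The $\omega$-mode-constrained problem is the problem with $Q=Q_\omega$. **Robust multi-mode problem.** For a mode sequence $(\omega_1,\dots,\omega_k)$, the multi-mode-constrained motion planning problem from $q_0$ to $Q_*$ is robustly feasible if there are sets $Q_0,\dots,Q_k$ and $\epsilon>0$ with: $Q_0=\{q_0\}$; for $i\in[k-1]$, $Q_i\subseteq Q_{ik}(t(\omega_i,\omega_{i+1}))$ and $\tilde\mu(Q_i;Q_{ik}(t(\omega_i,\omega_{i+1})))\ge\epsilon$; $Q_k\subseteq Q_*$ and $\tilde\mu(Q_k;Q_* )\ge\epsilon$; and for all $i\in[k]$, $q\in Q_{i-1}$, $q'\in Q_i$, the $\omega_i$-mode-constrained problem from $q$ to $q'$ is robustly feasible. **Robust PPM problem.** Starting from $\omega_1$,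 a mode sequence is determined by its successive parameters: each transfer mode $\omega_j$ ($j\ge2$) is given by its grasp of an object $o_{h_j}$, and each transit mode $\omega_i$ ($i\ge2$) by the new pose of the object $o_{h_{i-1}}$ held in $\omega_{i-1}$. $\Pi$ is robustly feasible if for some $k\ge1$, some fixed type (transit or transfer) pattern and fixed sequence of held objects, there are sets $G_j\subseteq\mathcal{G}^{o_{h_j}}$ (for transfer indices $j\ge2$) and $P_i\subseteq\mathcal{P}^{o_{h_{i-1}}}$ (for transit indices $i\ge2$), with product set of length-$k$ mode sequences $\theta$, such that every $(\omega_1,\dots,\omega_k)$ given by parameters in this product is a mode sequence with: $\omega_1$ the mode of $s_0$; the held grasp (or None) of $\omega_k$ in $G_*$ and the pose (or None) of each $o_j$ in $\omega_k$ in $P_*^{o_j}$; and the multi-mode-constrained problem from $q_0$ to $Q_*$ along it robustly feasible; and moreover $\tilde\mu(P_i)>0$ and $\tilde\mu(G_j)>0$ for all these indices. Here $\tilde\mu(P_i)$ is $\tilde\mu(P_i;P_*^{o_{h_{i-1}}})$ if $P_i\subseteq P_*^{o_{h_{i-1}}}$ and $\tilde\mu(P_i;\mathcal{P}^{o_{h_{i-1}}})$ otherwise; $\tilde\mu(G_j)$ is $\tilde\mu(G_j;G_* )$ if $o_{h_j}=o_{h_*}$ and $G_j\subseteq G_*$, and $\tilde\mu(G_j;\mathcal{G}^{o_{h_j}})$ otherwise. **FFRob (as analyzed).** Initially, for each $i$: $P^{o_i}(0)=\{p_0^{o_i}\}$, $G^{o_i}(0)=\emptyset$ if $o_i$ is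 placed in $s_0$, and $P^{o_i}(0)=\emptyset$, $G^{o_i}(0)=\{g_0\}$ if it is held; $Q^{o_i}(0)=\emptyset$; $V(0)=\{q_0\}$. At iteration $n\ge1$, with all draws independent (inverse-kinematics draws conditionally on the pair $(p,g)$), for each $i$: add to $P^{o_i}$ one sample from $\mathcal{P}^{o_i}$ and one from $P_*^{o_i}\setminus\{\mathrm{None}\}$ (if nonempty); add to $G^{o_i}$ one sample from $\mathcal{G}^{o_i}$ and, if $o_i=o_{h_*}$, one from $G_*$; add to $Q^{o_i}$, for every pair $(p,g)\in P^{o_i}(n)\times G^{o_i}(n)$, one new inverse-kinematics sample from $Q_{ik}(p\times\mathrm{transform}(g)^{-1})$ (if nonempty). Then $V(n)=V(n-1)\cup\bigcup_iQ^{o_i}(n)\cup\{q,q_*\}$ with $q\sim\mathcal{Q}$, $q_*\sim Q_*$, and $E(n)$ is the set of pairs in $V(n)$ whose connecting straight segment lies in $\mathcal{Q}$. A complete discrete search is then run from $s_0$ for a sequence of actions reaching $S_*$, where the actions are: Move$(q,q')$ for $q\ne q'\in V(n)$, changing the robot configuration from $q$ to $q'$, applicable if $(V(n),E(n))$ has a path from $q$ to $q'$ all of whose segments lie in $Q_\omega$ for the current mode $\omega$ (determined by the current held grasp and object poses); Pick$(o_i,p,g,q)$ and Place$(o_i,p,g,q)$ for $p\in P^{o_i}(n)$, $g\in G^{o_i}(n)$, $q\in Q^{o_i}(n)\cap Q_{ik}(p\times\mathrm{transform}(g)^{-1})$: Pick requires the robot at $q$ with empty hand and $o_i$ at $p$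 and results in holding $o_i$ with $g$; Place requires the robot at $q$ holding $o_i$ with $g$ and results in an empty hand and $o_i$ at $p$. FFRob stops and returns the plan at the first iteration whose discrete search succeeds; otherwise it proceeds to the next iteration. **Time.** Drawing one sample takes one time step. The discrete search of iteration $n$ is Dijkstra's algorithm on the directed graph whose vertices are the states $V'$ formed from the current samples and whose edges $E'$ are (state, applicable action) pairs, costing $O(|E'|+|V'|\log|V'|)$ time steps, where $|E'|$ is counted as at most the number of states times the number of actions. The time after $n$ iterations is the total over iterations $1,\dots,n$ of sampling and search time. *)

theory Defs
  imports "HOL-Probability.Probability"
begin

section \<open>Rigid transforms, modes and states\<close>

text \<open>The workspace is \<open>real^'w\<close>, the index type \<open>'o\<close> names the movable objects and \<open>'c\<close> is the
  ambient space of the configurations. Transforms act on the workspace, so their product is function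
  composition and their inverse is \<open>inv\<close>.\<close>

type_synonym 'w transform = "real^'w \<Rightarrow> real^'w"

definition rigid_transform :: "'w::finite transform \<Rightarrow> bool" where
  "rigid_transform t \<longleftrightarrow> (\<exists>R v. rotation_matrix R \<and> t = (\<lambda>x. R *v x + v))"

type_synonym ('o, 'w) grasp = "'o \<times> 'w transform"

text \<open>A mode is the pair of a held grasp and of the poses of the objects that are not held; a state
  is a configuration together with its mode. \<open>None\<close> as a grasp is the empty hand, so these modes
  are the transit modes.\<close>

type_synonym ('o, 'w) mode = "('o, 'w) grasp option \<times> ('o \<Rightarrow> 'w transform option)"

type_synonym ('c, 'o, 'w) state = "'c \<times> ('o, 'w) mode"

definition held :: "('o, 'w) mode \<Rightarrow> 'o option" where
  "held \<omega> = map_option fst (fst \<omega>)"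

text \<open>\<open>robot_body q\<close> is the region occupied by the robot at \<open>q\<close>; \<open>object_body i\<close> is the region
  occupied by the object \<open>i\<close> in its own frame. Two bodies collide if they share a point.\<close>

record ('c, 'o, 'w::finite) ppm_domain =
  confs :: "'c set"
  placements :: "'o \<Rightarrow> 'w transform set"
  grasps :: "'o \<Rightarrow> ('o, 'w) grasp set"
  ee :: "'c \<Rightarrow> 'w transform"
  robot_body :: "'c \<Rightarrow> (real^'w) set"
  object_body :: "'o \<Rightarrow> (real^'w) set"

definition ppm_domain :: "('c, 'o, 'w::finite) ppm_domain \<Rightarrow> bool" where
  "ppm_domain D \<longleftrightarrow>
     (\<forall>i. \<forall>p\<in>placements D i. rigid_transform p) \<and>
     (\<forall>i. \<forall>g\<in>grasps D i. fst g = i \<and> rigid_transform (snd g)) \<and>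
     (\<forall>q\<in>confs D. rigid_transform (ee D q))"

definition is_mode :: "('c, 'o, 'w::finite) ppm_domain \<Rightarrow> ('o, 'w) mode \<Rightarrow> bool" where
  "is_mode D \<omega> \<longleftrightarrow>
     (\<forall>g. fst \<omega> = Some g \<longrightarrow> g \<in> grasps D (fst g)) \<and>
     (\<forall>i p. snd \<omega> i = Some p \<longrightarrow> p \<in> placements D i) \<and>
     (\<forall>i. snd \<omega> i = None \<longleftrightarrow> held \<omega> = Some i)"

definition legal_mode :: "('c, 'o, 'w::finite) ppm_domain \<Rightarrow> ('o, 'w) mode \<Rightarrow> bool" where
  "legal_mode D \<omega> \<longleftrightarrow> is_mode D \<omega> \<and>
     (\<forall>i j p p'. i \<noteq> j \<and> snd \<omega> i = Some p \<and> snd \<omega> j = Some p' \<longrightarrow>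
        p ` object_body D i \<inter> p' ` object_body D j = {})"

definition held_body ::
    "('c, 'o, 'w::finite) ppm_domain \<Rightarrow> ('o, 'w) grasp \<Rightarrow> 'c \<Rightarrow> (real^'w) set" where
  "held_body D g q = (ee D q \<circ> snd g) ` object_body D (fst g)"

definition mode_confs :: "('c, 'o, 'w::finite) ppm_domain \<Rightarrow> ('o, 'w) mode \<Rightarrow> 'c set" where
  "mode_confs D \<omega> = {q \<in> confs D.
     (\<forall>i p. snd \<omega> i = Some p \<longrightarrow> robot_body D q \<inter> p ` object_body D i = {}) \<and>
     (\<forall>g. fst \<omega> = Some g \<longrightarrow>
        held_body D g q \<inter> robot_body D q = {} \<and>
        (\<forall>i p. snd \<omega> i = Some p \<longrightarrow> held_body D g q \<inter> p ` object_body D i = {}))}"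

definition legal_state :: "('c, 'o, 'w::finite) ppm_domain \<Rightarrow> ('c, 'o, 'w) state \<Rightarrow> bool" where
  "legal_state D s \<longleftrightarrow> legal_mode D (snd s) \<and> fst s \<in> mode_confs D (snd s)"


section \<open>Planning problems\<close>

record ('c, 'o, 'w::finite) ppm_problem =
  init_conf :: 'c
  init_mode :: "('o, 'w) mode"
  goal_confs :: "'c set"
  goal_grasps :: "('o, 'w) grasp option set"
  goal_poses :: "'o \<Rightarrow> 'w transform option set"

definition ppm_problem ::
    "('c, 'o, 'w::finite) ppm_domain \<Rightarrow> ('c, 'o, 'w) ppm_problem \<Rightarrow> bool" where
  "ppm_problem D \<P> \<longleftrightarrow>
     legal_state D (init_conf \<P>, init_mode \<P>) \<and>
     goal_confs \<P> \<subseteq> confs D \<and>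
     goal_grasps \<P> \<subseteq> insert None (Some ` (\<Union>i. grasps D i)) \<and>
     (\<forall>i. goal_poses \<P> i \<subseteq> insert None (Some ` placements D i))"

definition goal_mode :: "('c, 'o, 'w::finite) ppm_problem \<Rightarrow> ('o, 'w) mode \<Rightarrow> bool" where
  "goal_mode \<P> \<omega> \<longleftrightarrow> fst \<omega> \<in> goal_grasps \<P> \<and> (\<forall>i. snd \<omega> i \<in> goal_poses \<P> i)"

definition goal_states ::
    "('c, 'o, 'w::finite) ppm_domain \<Rightarrow> ('c, 'o, 'w) ppm_problem \<Rightarrow> ('c, 'o, 'w) state set" where
  "goal_states D \<P> = {s. legal_state D s \<and> fst s \<in> goal_confs \<P> \<and> goal_mode \<P> (snd s)}"

text \<open>\<open>goal_held D \<P> i\<close> says that \<open>i\<close> is the object that has to be held in the goal.\<close>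

definition goal_held ::
    "('c, 'o, 'w::finite) ppm_domain \<Rightarrow> ('c, 'o, 'w) ppm_problem \<Rightarrow> 'o \<Rightarrow> bool" where
  "goal_held D \<P> i \<longleftrightarrow> goal_grasps \<P> \<subseteq> Some ` grasps D i"


section \<open>Measures and samplers\<close>

text \<open>The three families assign to a space \<open>X\<close> the measure it is sampled with. Inverse kinematics
  for the transform \<open>t\<close> is run as \<open>ik t u\<close>, where \<open>u\<close> is a fresh random seed with law \<open>seed\<close>.\<close>

record ('c, 'o, 'w::finite, 'u) sampling =
  mu_conf :: "'c set \<Rightarrow> 'c measure"
  mu_pose :: "'o \<Rightarrow> 'w transform set \<Rightarrow> 'w transform measure"
  mu_grasp :: "('o, 'w) grasp set \<Rightarrow> ('o, 'w) grasp measure"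
  seed :: "'u measure"
  ik :: "'w transform \<Rightarrow> 'u \<Rightarrow> 'c"

definition sampled_space :: "('a set \<Rightarrow> 'a measure) \<Rightarrow> 'a set \<Rightarrow> bool" where
  "sampled_space mu X \<longleftrightarrow> space (mu X) = X \<and> 0 < emeasure (mu X) X \<and> emeasure (mu X) X < \<infinity>"

definition rel_measure :: "('a set \<Rightarrow> 'a measure) \<Rightarrow> 'a set \<Rightarrow> 'a set \<Rightarrow> real" where
  "rel_measure mu E X = measure (mu X) E / measure (mu X) X"

definition uniform_on :: "('a set \<Rightarrow> 'a measure) \<Rightarrow> 'a set \<Rightarrow> 'a measure" where
  "uniform_on mu X = uniform_measure (mu X) X"

definition ik_confs :: "('c, 'o, 'w::finite) ppm_domain \<Rightarrow> 'w transform \<Rightarrow> 'c set" where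
  "ik_confs D t = {q \<in> confs D. ee D q = t}"

definition ik_target :: "'w transform \<Rightarrow> ('o, 'w) grasp \<Rightarrow> 'w transform" where
  "ik_target p g = p \<circ> inv (snd g)"

definition valid_sampling ::
    "('c::euclidean_space, 'o, 'w::finite) ppm_domain \<Rightarrow> ('c, 'o, 'w) ppm_problem \<Rightarrow>
     ('c, 'o, 'w, 'u) sampling \<Rightarrow> bool" where
  "valid_sampling D \<P> S \<longleftrightarrow>
     confs D \<in> sets lebesgue \<and> mu_conf S (confs D) = lebesgue_on (confs D) \<and>
     sampled_space (mu_conf S) (confs D) \<and>
     sampled_space (mu_conf S) (goal_confs \<P>) \<and>
     (\<forall>i. sampled_space (mu_pose S i) (placements D i)) \<and>
     (\<forall>i. Option.these (goal_poses \<P> i) \<noteq> {} \<longrightarrow>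
        sampled_space (mu_pose S i) (Option.these (goal_poses \<P> i))) \<and>
     (\<forall>i. sampled_space (mu_grasp S) (grasps D i)) \<and>
     (\<forall>i. goal_held D \<P> i \<longrightarrow> sampled_space (mu_grasp S) (Option.these (goal_grasps \<P>))) \<and>
     (\<forall>t. ik_confs D t \<noteq> {} \<longrightarrow> sampled_space (mu_conf S) (ik_confs D t)) \<and>
     prob_space (seed S) \<and>
     (\<forall>t. ik_confs D t \<noteq> {} \<longrightarrow> ik S t \<in> measurable (seed S) (mu_conf S (ik_confs D t))) \<and>
     (\<exists>\<kappa>>0. \<forall>t. ik_confs D t \<noteq> {} \<longrightarrow> (\<forall>E \<in> sets (mu_conf S (ik_confs D t)).
        measure (seed S) {u \<in> space (seed S). ik S t u \<in> E}
          \<ge> \<kappa> * rel_measure (mu_conf S) E (ik_confs D t)))"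


section \<open>Robust feasibility\<close>

definition finite_length :: "(real \<Rightarrow> 'c::real_normed_vector) \<Rightarrow> bool" where
  "finite_length \<tau> \<longleftrightarrow> (\<exists>L. \<forall>(t::nat \<Rightarrow> real) n. incseq t \<and> range t \<subseteq> {0..1} \<longrightarrow>
     (\<Sum>i<n. norm (\<tau> (t (Suc i)) - \<tau> (t i))) \<le> L)"

definition robust_motion :: "'c::euclidean_space set \<Rightarrow> 'c \<Rightarrow> 'c \<Rightarrow> bool" where
  "robust_motion Q q0 q1 \<longleftrightarrow> q0 \<in> Q \<and> q1 \<in> Q \<and>
     (\<exists>\<delta>>0. \<exists>\<tau>. path \<tau> \<and> finite_length \<tau> \<and> path_image \<tau> \<subseteq> Q \<and>
        (\<forall>x\<in>path_image \<tau>. \<forall>y\<in>frontier Q. \<delta> \<le> dist x y) \<and>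
        (\<forall>q\<in>Q. dist q (pathstart \<tau>) \<le> \<delta> / 2 \<longrightarrow> closed_segment q0 q \<subseteq> Q) \<and>
        (\<forall>q\<in>Q. dist q (pathfinish \<tau>) \<le> \<delta> / 2 \<longrightarrow> closed_segment q q1 \<subseteq> Q))"

fun switch_transform :: "('o, 'w) mode \<Rightarrow> ('o, 'w) mode \<Rightarrow> 'w transform" where
  "switch_transform (None, p) (Some g, p') = ik_target (the (p (fst g))) g"
| "switch_transform (Some g, p') (None, p) = ik_target (the (p (fst g))) g"

definition adjacent ::
    "('c, 'o, 'w::finite) ppm_domain \<Rightarrow> ('o, 'w) mode \<Rightarrow> ('o, 'w) mode \<Rightarrow> bool" where
  "adjacent D \<omega> \<omega>' \<longleftrightarrow>
     (fst \<omega> = None \<longleftrightarrow> fst \<omega>' \<noteq> None) \<and>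
     (\<forall>j. held \<omega> \<noteq> Some j \<and> held \<omega>' \<noteq> Some j \<longrightarrow> snd \<omega> j = snd \<omega>' j) \<and>
     mode_confs D \<omega> \<inter> mode_confs D \<omega>' \<inter> ik_confs D (switch_transform \<omega> \<omega>') \<noteq> {}"

text \<open>Sequences of length \<open>k\<close> are functions on \<open>nat\<close> of which the values at \<open>1, \<dots>, k\<close> are used.\<close>

definition mode_sequence ::
    "('c, 'o, 'w::finite) ppm_domain \<Rightarrow> nat \<Rightarrow> (nat \<Rightarrow> ('o, 'w) mode) \<Rightarrow> bool" where
  "mode_sequence D k \<omega> \<longleftrightarrow>
     (\<forall>i\<in>{1..k}. legal_mode D (\<omega> i)) \<and> (\<forall>i\<in>{1..<k}. adjacent D (\<omega> i) (\<omega> (Suc i)))"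

definition robust_multi_mode ::
    "('c::euclidean_space, 'o, 'w::finite) ppm_domain \<Rightarrow> ('c set \<Rightarrow> 'c measure) \<Rightarrow> 'c \<Rightarrow> 'c set \<Rightarrow>
     nat \<Rightarrow> (nat \<Rightarrow> ('o, 'w) mode) \<Rightarrow> bool" where
  "robust_multi_mode D mu q0 Qg k \<omega> \<longleftrightarrow>
     (\<exists>(Qs :: nat \<Rightarrow> 'c set) \<epsilon>. \<epsilon> > 0 \<and> Qs 0 = {q0} \<and>
        (\<forall>i\<in>{1..<k}. let X = ik_confs D (switch_transform (\<omega> i) (\<omega> (Suc i)))
           in Qs i \<subseteq> X \<and> Qs i \<in> sets (mu X) \<and> rel_measure mu (Qs i) X \<ge> \<epsilon>) \<and>
        Qs k \<subseteq> Qg \<and> Qs k \<in> sets (mu Qg) \<and> rel_measure mu (Qs k) Qg \<ge> \<epsilon> \<and>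
        (\<forall>i\<in>{1..k}. \<forall>q\<in>Qs (i - 1). \<forall>q'\<in>Qs i. robust_motion (mode_confs D (\<omega> i)) q q'))"

text \<open>\<open>h i\<close> is the object held in the \<open>i\<close>-th mode (\<open>None\<close> for a transit mode). A transfer mode replaces
  the pose of its object by the grasp \<open>g i\<close>, a transit mode places the previously held object at \<open>p i\<close>.\<close>

primrec param_modes ::
    "('o, 'w) mode \<Rightarrow> (nat \<Rightarrow> 'o option) \<Rightarrow> (nat \<Rightarrow> ('o, 'w) grasp) \<Rightarrow> (nat \<Rightarrow> 'w transform) \<Rightarrow>
     nat \<Rightarrow> ('o, 'w) mode" where
  "param_modes \<omega>\<^sub>1 h g p 0 = \<omega>\<^sub>1"
| "param_modes \<omega>\<^sub>1 h g p (Suc n) = (if n = 0 then \<omega>\<^sub>1 else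
     let \<omega> = param_modes \<omega>\<^sub>1 h g p n in
     case h (Suc n) of
       Some i \<Rightarrow> (Some (g (Suc n)), (snd \<omega>)(i := None))
     | None \<Rightarrow> (None, (snd \<omega>)(the (h n) := Some (p (Suc n)))))"

definition pose_measure ::
    "('c, 'o, 'w::finite) ppm_domain \<Rightarrow> ('c, 'o, 'w) ppm_problem \<Rightarrow> ('c, 'o, 'w, 'u) sampling \<Rightarrow>
     'o \<Rightarrow> 'w transform set \<Rightarrow> real" where
  "pose_measure D \<P> S i P =
     (if P \<subseteq> Option.these (goal_poses \<P> i)
      then rel_measure (mu_pose S i) P (Option.these (goal_poses \<P> i))
      else rel_measure (mu_pose S i) P (placements D i))"

definition grasp_measure ::
    "('c, 'o, 'w::finite) ppm_domain \<Rightarrow> ('c, 'o, 'w) ppm_problem \<Rightarrow> ('c, 'o, 'w, 'u) sampling \<Rightarrow>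
     'o \<Rightarrow> ('o, 'w) grasp set \<Rightarrow> real" where
  "grasp_measure D \<P> S i G =
     (if goal_held D \<P> i \<and> G \<subseteq> Option.these (goal_grasps \<P>)
      then rel_measure (mu_grasp S) G (Option.these (goal_grasps \<P>))
      else rel_measure (mu_grasp S) G (grasps D i))"

definition robustly_feasible ::
    "('c::euclidean_space, 'o, 'w::finite) ppm_domain \<Rightarrow> ('c, 'o, 'w) ppm_problem \<Rightarrow>
     ('c, 'o, 'w, 'u) sampling \<Rightarrow> bool" where
  "robustly_feasible D \<P> S \<longleftrightarrow>
     (\<exists>k\<ge>1. \<exists>(h :: nat \<Rightarrow> 'o option) Gs Ps.
        h 1 = held (init_mode \<P>) \<and>
        (\<forall>i\<in>{2..k}. case h i of
             Some j \<Rightarrow> Gs i \<subseteq> grasps D j \<and> grasp_measure D \<P> S j (Gs i) > 0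
           | None \<Rightarrow> Ps i \<subseteq> placements D (the (h (i - 1))) \<and>
                     pose_measure D \<P> S (the (h (i - 1))) (Ps i) > 0) \<and>
        (\<forall>g p. (\<forall>i\<in>{2..k}. case h i of Some j \<Rightarrow> g i \<in> Gs i | None \<Rightarrow> p i \<in> Ps i) \<longrightarrow>
           (let \<omega> = param_modes (init_mode \<P>) h g p in
              mode_sequence D k \<omega> \<and> goal_mode \<P> (\<omega> k) \<and>
              robust_multi_mode D (mu_conf S) (init_conf \<P>) (goal_confs \<P>) k \<omega>)))"


section \<open>The random draws of the algorithm\<close>

text \<open>A pose or a grasp in the current samples is the initial one, or was drawn in iteration \<open>k\<close>
  from the full space (\<open>Uniform k\<close>) or from the goal set (\<open>Goal k\<close>).\<close>

datatype source = Initial | Uniform nat | Goal nat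

text \<open>One outcome of all draws, indexed by the iteration and the object: poses, goal poses, grasps,
  goal grasps, configurations, goal configurations, and seeds for inverse kinematics. The seeds are
  indexed also by the sources of the pose and of the grasp.\<close>

type_synonym ('c, 'o, 'w, 'u) draws =
  "(nat \<times> 'o \<Rightarrow> 'w transform) \<times> (nat \<times> 'o \<Rightarrow> 'w transform) \<times>
   (nat \<times> 'o \<Rightarrow> ('o, 'w) grasp) \<times> (nat \<times> 'o \<Rightarrow> ('o, 'w) grasp) \<times>
   (nat \<Rightarrow> 'c) \<times> (nat \<Rightarrow> 'c) \<times> (nat \<times> 'o \<times> source \<times> source \<Rightarrow> 'u)"

definition draw_space ::
    "('c, 'o, 'w::finite) ppm_domain \<Rightarrow> ('c, 'o, 'w) ppm_problem \<Rightarrow> ('c, 'o, 'w, 'u) sampling \<Rightarrow>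
     ('c, 'o, 'w, 'u) draws measure" where
  "draw_space D \<P> S =
     (\<Pi>\<^sub>M (n, i)\<in>UNIV. uniform_on (mu_pose S i) (placements D i)) \<Otimes>\<^sub>M
     (\<Pi>\<^sub>M (n, i)\<in>UNIV \<times> {i. Option.these (goal_poses \<P> i) \<noteq> {}}.
        uniform_on (mu_pose S i) (Option.these (goal_poses \<P> i))) \<Otimes>\<^sub>M
     (\<Pi>\<^sub>M (n, i)\<in>UNIV. uniform_on (mu_grasp S) (grasps D i)) \<Otimes>\<^sub>M
     (\<Pi>\<^sub>M (n, i)\<in>UNIV \<times> {i. goal_held D \<P> i}.
        uniform_on (mu_grasp S) (Option.these (goal_grasps \<P>))) \<Otimes>\<^sub>M
     (\<Pi>\<^sub>M n\<in>UNIV. uniform_on (mu_conf S) (confs D)) \<Otimes>\<^sub>M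
     (\<Pi>\<^sub>M n\<in>UNIV. uniform_on (mu_conf S) (goal_confs \<P>)) \<Otimes>\<^sub>M
     (\<Pi>\<^sub>M x\<in>UNIV. seed S)"

fun pose_source ::
    "('c, 'o, 'w::finite) ppm_problem \<Rightarrow> ('c, 'o, 'w, 'u) draws \<Rightarrow> 'o \<Rightarrow> source \<Rightarrow>
     'w transform option" where
  "pose_source \<P> (x, xg, y, yg, c, cg, u) i Initial = snd (init_mode \<P>) i"
| "pose_source \<P> (x, xg, y, yg, c, cg, u) i (Uniform k) = Some (x (k, i))"
| "pose_source \<P> (x, xg, y, yg, c, cg, u) i (Goal k) =
     (if Option.these (goal_poses \<P> i) \<noteq> {} then Some (xg (k, i)) else None)"

fun grasp_source ::
    "('c, 'o, 'w::finite) ppm_domain \<Rightarrow> ('c, 'o, 'w) ppm_problem \<Rightarrow> ('c, 'o, 'w, 'u) draws \<Rightarrow>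
     'o \<Rightarrow> source \<Rightarrow> ('o, 'w) grasp option" where
  "grasp_source D \<P> (x, xg, y, yg, c, cg, u) i Initial =
     (if held (init_mode \<P>) = Some i then fst (init_mode \<P>) else None)"
| "grasp_source D \<P> (x, xg, y, yg, c, cg, u) i (Uniform k) = Some (y (k, i))"
| "grasp_source D \<P> (x, xg, y, yg, c, cg, u) i (Goal k) =
     (if goal_held D \<P> i then Some (yg (k, i)) else None)"

fun conf_draw :: "('c, 'o, 'w, 'u) draws \<Rightarrow> nat \<Rightarrow> 'c" where
  "conf_draw (x, xg, y, yg, c, cg, u) k = c k"

fun goal_conf_draw :: "('c, 'o, 'w, 'u) draws \<Rightarrow> nat \<Rightarrow> 'c" where
  "goal_conf_draw (x, xg, y, yg, c, cg, u) k = cg k"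

fun seed_draw :: "('c, 'o, 'w, 'u) draws \<Rightarrow> nat \<times> 'o \<times> source \<times> source \<Rightarrow> 'u" where
  "seed_draw (x, xg, y, yg, c, cg, u) a = u a"

definition samples :: "(source \<Rightarrow> 'a option) \<Rightarrow> nat \<Rightarrow> 'a set" where
  "samples f n = {v. f Initial = Some v \<or> (\<exists>k\<in>{1..n}. f (Uniform k) = Some v \<or> f (Goal k) = Some v)}"

text \<open>An address that is injective on \<open>samples f n\<close>. Each sampled (pose, grasp) pair receives the seed
  stored at its pair of addresses, hence one fresh independent seed per iteration even if an element
  was drawn repeatedly; among several sources of an element, the initial one is preferred, then the
  latest. Any other injective choice gives the same law.\<close>

definition address :: "(source \<Rightarrow> 'a option) \<Rightarrow> nat \<Rightarrow> 'a \<Rightarrow> source" where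
  "address f n v =
     (if f Initial = Some v then Initial else
      let k = Max {k\<in>{1..n}. f (Uniform k) = Some v \<or> f (Goal k) = Some v}
      in if f (Uniform k) = Some v then Uniform k else Goal k)"


section \<open>The algorithm\<close>

datatype ('c, 'o, 'w) action =
    Move 'c 'c
  | Pick 'o "'w transform" "('o, 'w) grasp" 'c
  | Place 'o "'w transform" "('o, 'w) grasp" 'c

context
  fixes D :: "('c::euclidean_space, 'o::finite, 'w::finite) ppm_domain"
    and \<P> :: "('c, 'o, 'w) ppm_problem"
    and S :: "('c, 'o, 'w, 'u) sampling"
begin

definition pose_samples :: "('c, 'o, 'w, 'u) draws \<Rightarrow> 'o \<Rightarrow> nat \<Rightarrow> 'w transform set" where
  "pose_samples w i n = samples (pose_source \<P> w i) n"

definition grasp_samples :: "('c, 'o, 'w, 'u) draws \<Rightarrow> 'o \<Rightarrow> nat \<Rightarrow> ('o, 'w) grasp set" where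
  "grasp_samples w i n = samples (grasp_source D \<P> w i) n"

definition ik_pairs ::
    "('c, 'o, 'w, 'u) draws \<Rightarrow> 'o \<Rightarrow> nat \<Rightarrow> ('w transform \<times> ('o, 'w) grasp) set" where
  "ik_pairs w i n =
     {(p, g) \<in> pose_samples w i n \<times> grasp_samples w i n. ik_confs D (ik_target p g) \<noteq> {}}"

definition ik_samples :: "('c, 'o, 'w, 'u) draws \<Rightarrow> 'o \<Rightarrow> nat \<Rightarrow> 'c set" where
  "ik_samples w i n = (\<Union>k\<in>{1..n}. (\<lambda>(p, g). ik S (ik_target p g)
     (seed_draw w (k, i, address (pose_source \<P> w i) k p, address (grasp_source D \<P> w i) k g)))
       ` ik_pairs w i k)"

definition vertices :: "('c, 'o, 'w, 'u) draws \<Rightarrow> nat \<Rightarrow> 'c set" where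
  "vertices w n = {init_conf \<P>} \<union> (\<Union>i. ik_samples w i n) \<union>
     conf_draw w ` {1..n} \<union> goal_conf_draw w ` {1..n}"

definition edges :: "('c, 'o, 'w, 'u) draws \<Rightarrow> nat \<Rightarrow> ('c \<times> 'c) set" where
  "edges w n = {(q, q') \<in> vertices w n \<times> vertices w n. closed_segment q q' \<subseteq> confs D}"

definition actions :: "('c, 'o, 'w, 'u) draws \<Rightarrow> nat \<Rightarrow> ('c, 'o, 'w) action set" where
  "actions w n =
     {Move q q' | q q'. q \<in> vertices w n \<and> q' \<in> vertices w n \<and> q \<noteq> q'} \<union>
     {Pick i p g q | i p g q. p \<in> pose_samples w i n \<and> g \<in> grasp_samples w i n \<and>
        q \<in> ik_samples w i n \<inter> ik_confs D (ik_target p g)} \<union>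
     {Place i p g q | i p g q. p \<in> pose_samples w i n \<and> g \<in> grasp_samples w i n \<and>
        q \<in> ik_samples w i n \<inter> ik_confs D (ik_target p g)}"

text \<open>\<open>step w n a s s'\<close>: the action \<open>a\<close> is applicable in \<open>s\<close> and results in \<open>s'\<close>.\<close>

inductive step ::
    "('c, 'o, 'w, 'u) draws \<Rightarrow> nat \<Rightarrow> ('c, 'o, 'w) action \<Rightarrow> ('c, 'o, 'w) state \<Rightarrow>
     ('c, 'o, 'w) state \<Rightarrow> bool"
  for w :: "('c, 'o, 'w, 'u) draws" and n :: nat where
  "(q, q') \<in> {(x, y) \<in> edges w n. closed_segment x y \<subseteq> mode_confs D \<omega>}\<^sup>* \<Longrightarrow>
     step w n (Move q q') (q, \<omega>) (q', \<omega>)"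
| "ps i = Some p \<Longrightarrow> step w n (Pick i p g q) (q, None, ps) (q, Some g, ps(i := None))"
| "fst g = i \<Longrightarrow> step w n (Place i p g q) (q, Some g, ps) (q, None, ps(i := Some p))"

definition solved :: "('c, 'o, 'w, 'u) draws \<Rightarrow> nat \<Rightarrow> bool" where
  "solved w n \<longleftrightarrow> (\<exists>s \<in> goal_states D \<P>.
     ((init_conf \<P>, init_mode \<P>), s) \<in> {(s, s'). \<exists>a \<in> actions w n. step w n a s s'}\<^sup>*)"

definition search_states :: "('c, 'o, 'w, 'u) draws \<Rightarrow> nat \<Rightarrow> ('c, 'o, 'w) state set" where
  "search_states w n = {(q, \<omega>). q \<in> vertices w n \<and>
     (\<forall>g. fst \<omega> = Some g \<longrightarrow> g \<in> grasp_samples w (fst g) n) \<and>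
     (\<forall>i p. snd \<omega> i = Some p \<longrightarrow> p \<in> pose_samples w i n) \<and>
     (\<forall>i. snd \<omega> i = None \<longleftrightarrow> held \<omega> = Some i)}"

definition sampling_time :: "('c, 'o, 'w, 'u) draws \<Rightarrow> nat \<Rightarrow> nat" where
  "sampling_time w n =
     (\<Sum>i\<in>UNIV. 1 + of_bool (Option.these (goal_poses \<P> i) \<noteq> {}) +
        1 + of_bool (goal_held D \<P> i) + card (ik_pairs w i n)) + 2"

text \<open>\<open>search_time w n\<close> is the number of time steps of the discrete search of iteration \<open>n\<close>. The
  additive constant covers search graphs with a single state and no action.\<close>

definition dijkstra_cost :: "(('c, 'o, 'w, 'u) draws \<Rightarrow> nat \<Rightarrow> nat) \<Rightarrow> bool" where
  "dijkstra_cost search_time \<longleftrightarrow>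
     (\<exists>C. \<forall>w \<in> space (draw_space D \<P> S). \<forall>n\<ge>1.
        let v = real (card (search_states w n)); a = real (card (actions w n))
        in real (search_time w n) \<le> C * (1 + v * a + v * ln v))"

definition elapsed ::
    "(('c, 'o, 'w, 'u) draws \<Rightarrow> nat \<Rightarrow> nat) \<Rightarrow> ('c, 'o, 'w, 'u) draws \<Rightarrow> nat \<Rightarrow> nat" where
  "elapsed search_time w n = (\<Sum>j=1..n. sampling_time w j + search_time w j)"

definition runtime ::
    "(('c, 'o, 'w, 'u) draws \<Rightarrow> nat \<Rightarrow> nat) \<Rightarrow> ('c, 'o, 'w, 'u) draws \<Rightarrow> ennreal" where
  "runtime search_time w =
     (if \<exists>n\<ge>1. solved w n
      then of_nat (elapsed search_time w (LEAST n. 1 \<le> n \<and> solved w n)) else \<infinity>)"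

text \<open>Every event that refers to the outcome of the draws is taken to be measurable.\<close>

definition measurable_run :: "(('c, 'o, 'w, 'u) draws \<Rightarrow> nat \<Rightarrow> nat) \<Rightarrow> bool" where
  "measurable_run search_time \<longleftrightarrow>
     (\<forall>n\<ge>1. {w \<in> space (draw_space D \<P> S). solved w n} \<in> sets (draw_space D \<P> S)) \<and>
     runtime search_time \<in> borel_measurable (draw_space D \<P> S)"

end

definition mean :: "'a measure \<Rightarrow> ('a \<Rightarrow> ennreal) \<Rightarrow> ennreal" where
  "mean M T = (\<integral>\<^sup>+ w. T w \<partial>M)"

text \<open>Only meaningful if \<open>mean M T < \<infinity>\<close>, when \<open>T\<close> is finite almost everywhere. The nonnegative
  integral is used so that an infinite variance is not collapsed to 0.\<close>

definition var :: "'a measure \<Rightarrow> ('a \<Rightarrow> ennreal) \<Rightarrow> ennreal" where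
  "var M T = (\<integral>\<^sup>+ w. ennreal ((enn2real (T w) - enn2real (mean M T))\<^sup>2) \<partial>M)"

end

theory Submission
  imports Defs
begin

text \<open>The iterations of a run form a stationary sequence of independent blocks: a run that is restarted
  after \<open>N\<close> iterations, with the earlier samples discarded, is embedded in the original run, and more
  samples never invalidate a plan. Hence the probability \<open>u n\<close> of being unsolved after \<open>n\<close> iterations is
  submultiplicative, and it decays geometrically as soon as \<open>u N < 1\<close> for one \<open>N\<close>. As the cost of an
  iteration is polynomial in its number, all moments of the runtime are then finite.

  That some \<open>u N\<close> is below 1 needs no bound that is uniform in the parameters. If almost every run stayed
  unsolved, then by Fubini's theorem this would hold for almost all seeds and configurations after
  suitable poses and grasps have been fixed in the given sets of positive measure; then for almost all
  configurations after the transition configurations have been fixed; but finitely many balls, which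
  have positive measure, now suffice to connect the transitions of the fixed mode sequence.\<close>

text \<open>Success in iteration \<open>n\<close> depends on all earlier samples, so the iterations
  are not independent trials; comparing a run with two shorter independent runs restores
  independence. Both shorter runs share the initial poses and grasp, so the source
  \<open>Initial\<close> stays fixed when all other sources are shifted. The constants \<delta>,
  \<epsilon> and the sets \<open>Qs\<close> of a robust problem come from existential quantifiers
  below the quantification over the parameters, and nothing makes them measurable functions of the
  parameters. Lower bounds for fixed parameters can therefore not simply be integrated. In the
  argument by contradiction a single point is chosen at each stage. The order of the choices is
  forced: poses and grasps determine the targets of inverse kinematics, and the goal and transition
  configurations determine which balls the free configurations have to hit.\<close>

section \<open>Product probability spaces\<close>

text \<open>The cylinder over \<open>J\<close> has as measure a product of finitely many positive
  factors, so it is not null and cannot avoid a set of full measure. All draws are later chosen in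
  this way: finitely many coordinates are steered, the others stay generic.\<close>

lemma AE_PiM_obtain:
  assumes M: "\<And>i. i \<in> I \<Longrightarrow> prob_space (M i)"
    and J: "finite J" "J \<subseteq> I"
    and A: "\<And>j. j \<in> J \<Longrightarrow> A j \<in> sets (M j)" "\<And>j. j \<in> J \<Longrightarrow> 0 < emeasure (M j) (A j)"
    and P: "AE \<omega> in PiM I M. P \<omega>"
  obtains \<omega> where "\<omega> \<in> space (PiM I M)" "\<And>j. j \<in> J \<Longrightarrow> \<omega> j \<in> A j" "P \<omega>"
proof -
  let ?C = "prod_emb I M J (Pi\<^sub>E J A)"
  have C: "?C \<in> sets (PiM I M)"
    using J A by (intro sets_PiM_I) auto
  have "emeasure (PiM I M) ?C = (\<Prod>j\<in>J. emeasure (M j) (A j))"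
    by (intro emeasure_PiM_emb M J A)
  also have "\<dots> \<noteq> 0"
    using J A(2) by (force simp: prod_zero_iff)
  finally have pos: "emeasure (PiM I M) ?C \<noteq> 0" .
  have "\<exists>\<omega>\<in>?C. P \<omega>"
  proof (rule ccontr)
    assume "\<not> (\<exists>\<omega>\<in>?C. P \<omega>)"
    with P have "AE \<omega> in PiM I M. \<omega> \<notin> ?C"
      by (auto elim: eventually_mono)
    then show False
      using pos AE_iff_null_sets[OF C] by auto
  qed
  then obtain \<omega> where \<omega>: "\<omega> \<in> ?C" "P \<omega>" by blast
  show thesis
  proof
    show "\<omega> \<in> space (PiM I M)" using \<omega>(1) C sets.sets_into_space by blast
    show "\<omega> j \<in> A j" if "j \<in> J" for j
      using \<omega>(1) that by (auto simp: prod_emb_def PiE_iff dest: restrict_apply')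
    show "P \<omega>" by fact
  qed
qed

lemma emeasure_distr_nn_integral:
  assumes "f \<in> measurable M N" "A \<in> sets N"
  shows "emeasure (distr M N f) A = (\<integral>\<^sup>+ x. indicator A (f x) \<partial>M)"
  using nn_integral_distr[OF assms(1), of "indicator A"] assms(2) by simp

section \<open>Merging two independent samples into one\<close>

definition pair_map :: "('a \<times> 'a \<Rightarrow> 'a) \<Rightarrow> ('b \<times> 'b \<Rightarrow> 'b) \<Rightarrow> ('a \<times> 'b) \<times> ('a \<times> 'b) \<Rightarrow> 'a \<times> 'b" where
  "pair_map f g = (\<lambda>w. (f (fst (fst w), fst (snd w)), g (snd (fst w), snd (snd w))))"

lemma pair_map_simp [simp]: "pair_map f g ((a, b), (a', b')) = (f (a, a'), g (b, b'))"
  by (simp add: pair_map_def)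

lemma prob_space_pair_measure:
  assumes "prob_space M" "prob_space N"
  shows "prob_space (M \<Otimes>\<^sub>M N)"
proof -
  interpret M: prob_space M by fact
  interpret N: prob_space N by fact
  interpret MN: pair_prob_space M N ..
  show ?thesis by (rule MN.P.prob_space_axioms)
qed

text \<open>The form in which independence and stationarity of the draws enter: merging two
  independent samples by \<open>f\<close> gives one sample of the same law. The notion is stable
  under products, so each component of the draws can be treated alone.\<close>

definition combines :: "'a measure \<Rightarrow> ('a \<times> 'a \<Rightarrow> 'a) \<Rightarrow> bool" where
  "combines M f \<longleftrightarrow> f \<in> measurable (M \<Otimes>\<^sub>M M) M \<and> distr (M \<Otimes>\<^sub>M M) M f = M"

text \<open>A product measure is determined by rectangles. On a rectangle the integrand splits into
  a factor in the two \<open>M\<close>-coordinates and one in the two \<open>N\<close>-coordinates,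
  and Fubini reduces each factor to one hypothesis.\<close>

lemma combines_pair:
  assumes "prob_space M" "prob_space N" and f: "combines M f" and g: "combines N g"
  shows "combines (M \<Otimes>\<^sub>M N) (pair_map f g)"
proof -
  interpret M: prob_space M by fact
  interpret N: prob_space N by fact
  interpret MN: pair_prob_space M N ..
  interpret MM: pair_prob_space M M ..
  interpret NN: pair_prob_space N N ..
  let ?h = "\<lambda>w. (f (fst (fst w), fst (snd w)), g (snd (fst w), snd (snd w)))"
  let ?Q = "(M \<Otimes>\<^sub>M N) \<Otimes>\<^sub>M (M \<Otimes>\<^sub>M N)"
  have [measurable]: "f \<in> measurable (M \<Otimes>\<^sub>M M) M" "g \<in> measurable (N \<Otimes>\<^sub>M N) N"
    using f g by (auto simp: combines_def)
  have h[measurable]: "?h \<in> measurable ?Q (M \<Otimes>\<^sub>M N)"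
    by measurable
  have "M \<Otimes>\<^sub>M N = distr ?Q (M \<Otimes>\<^sub>M N) ?h"
  proof (rule pair_measure_eqI)
    show "sigma_finite_measure M" "sigma_finite_measure N" ..
    show "sets (M \<Otimes>\<^sub>M N) = sets (distr ?Q (M \<Otimes>\<^sub>M N) ?h)" by simp
    fix A B assume [measurable]: "A \<in> sets M" "B \<in> sets N"
    have "emeasure (distr ?Q (M \<Otimes>\<^sub>M N) ?h) (A \<times> B) =
        (\<integral>\<^sup>+ w. indicator (A \<times> B) (?h w) \<partial>?Q)"
      by (rule emeasure_distr_nn_integral) simp_all
    also have "\<dots> = (\<integral>\<^sup>+ w. indicator A (f (fst (fst w), fst (snd w))) *
        indicator B (g (snd (fst w), snd (snd w))) \<partial>?Q)"
      by (intro nn_integral_cong) (auto simp: indicator_def)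
    also have "\<dots> = (\<integral>\<^sup>+ z. \<integral>\<^sup>+ z'. indicator A (f (fst z, fst z')) *
        indicator B (g (snd z, snd z')) \<partial>(M \<Otimes>\<^sub>M N) \<partial>(M \<Otimes>\<^sub>M N))"
      by (subst MN.P.nn_integral_fst[symmetric]) simp_all
    also have "\<dots> = (\<integral>\<^sup>+ z. \<integral>\<^sup>+ a'. \<integral>\<^sup>+ b'. indicator A (f (fst z, a')) *
        indicator B (g (snd z, b')) \<partial>N \<partial>M \<partial>(M \<Otimes>\<^sub>M N))"
      by (intro nn_integral_cong, subst N.nn_integral_fst[symmetric])
        (auto simp: space_pair_measure)
    also have "\<dots> = (\<integral>\<^sup>+ z. (\<integral>\<^sup>+ a'. indicator A (f (fst z, a')) \<partial>M) *
        (\<integral>\<^sup>+ b'. indicator B (g (snd z, b')) \<partial>N) \<partial>(M \<Otimes>\<^sub>M N))"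
      by (intro nn_integral_cong)
        (auto simp: space_pair_measure nn_integral_cmult nn_integral_multc)
    also have "\<dots> = (\<integral>\<^sup>+ a. \<integral>\<^sup>+ b. (\<integral>\<^sup>+ a'. indicator A (f (a, a')) \<partial>M) *
        (\<integral>\<^sup>+ b'. indicator B (g (b, b')) \<partial>N) \<partial>N \<partial>M)"
      by (subst N.nn_integral_fst[symmetric]) simp_all
    also have "\<dots> = (\<integral>\<^sup>+ a. \<integral>\<^sup>+ a'. indicator A (f (a, a')) \<partial>M \<partial>M) *
        (\<integral>\<^sup>+ b. \<integral>\<^sup>+ b'. indicator B (g (b, b')) \<partial>N \<partial>N)"
      by (simp add: nn_integral_cmult nn_integral_multc)
    also have "(\<integral>\<^sup>+ a. \<integral>\<^sup>+ a'. indicator A (f (a, a')) \<partial>M \<partial>M) =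
        (\<integral>\<^sup>+ z. indicator A (f z) \<partial>(M \<Otimes>\<^sub>M M))"
      by (subst M.nn_integral_fst[symmetric]) simp_all
    also have "\<dots> = emeasure (distr (M \<Otimes>\<^sub>M M) M f) A"
      by (rule emeasure_distr_nn_integral[symmetric]) simp_all
    also have "\<dots> = emeasure M A" using f by (simp add: combines_def)
    also have "(\<integral>\<^sup>+ b. \<integral>\<^sup>+ b'. indicator B (g (b, b')) \<partial>N \<partial>N) =
        (\<integral>\<^sup>+ z. indicator B (g z) \<partial>(N \<Otimes>\<^sub>M N))"
      by (subst N.nn_integral_fst[symmetric]) simp_all
    also have "\<dots> = emeasure (distr (N \<Otimes>\<^sub>M N) N g) B"
      by (rule emeasure_distr_nn_integral[symmetric]) simp_all
    also have "\<dots> = emeasure N B" using g by (simp add: combines_def)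
    finally show "emeasure M A * emeasure N B = emeasure (distr ?Q (M \<Otimes>\<^sub>M N) ?h) (A \<times> B)"
      by simp
  qed
  with h show ?thesis by (simp add: combines_def pair_map_def)
qed

text \<open>\<open>K\<close> is the past and comes from the first sample; a later coordinate
  \<open>i\<close> reads the second sample at its restarted index \<open>s i\<close>. The
  restriction to \<open>I\<close> keeps the result extensional, as the product space
  requires.\<close>

definition shift_merge :: "'i set \<Rightarrow> 'i set \<Rightarrow> ('i \<Rightarrow> 'i) \<Rightarrow> ('i \<Rightarrow> 'a) \<times> ('i \<Rightarrow> 'a) \<Rightarrow> 'i \<Rightarrow> 'a" where
  "shift_merge I K s = (\<lambda>(\<omega>, \<omega>'). \<lambda>i\<in>I. if i \<in> K then \<omega> i else \<omega>' (s i))"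

text \<open>The law is determined by finite cylinders, and the preimage of a cylinder is a product
  of a cylinder in the first sample and one in the second. Injectivity keeps the constraints on the
  second sample on distinct coordinates, so that its measure factorizes; equal laws at
  \<open>i\<close> and \<open>s i\<close> make the factors agree.\<close>

lemma combines_shift_merge:
  assumes M: "\<And>i. i \<in> I \<Longrightarrow> prob_space (M i)"
    and s: "inj_on s (I - K)" "\<And>i. i \<in> I - K \<Longrightarrow> s i \<in> I" "\<And>i. i \<in> I - K \<Longrightarrow> M (s i) = M i"
  shows "combines (PiM I M) (shift_merge I K s)"
proof -
  let ?P = "PiM I M"
  interpret P: prob_space ?P by (rule prob_space_PiM) (rule M)
  interpret PP: pair_prob_space ?P ?P ..
  have f[measurable]: "shift_merge I K s \<in> measurable (?P \<Otimes>\<^sub>M ?P) ?P"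
    unfolding shift_merge_def split_beta'
  proof (rule measurable_restrict)
    fix i assume i: "i \<in> I"
    show "(\<lambda>w. if i \<in> K then fst w i else snd w (s i)) \<in> measurable (?P \<Otimes>\<^sub>M ?P) (M i)"
    proof (cases "i \<in> K")
      case True
      then show ?thesis using i by simp
    next
      case False
      then have "(\<lambda>w. snd w (s i)) \<in> measurable (?P \<Otimes>\<^sub>M ?P) (M (s i))"
        using i s(2)[of i] by simp
      then show ?thesis using False i s(3) by simp
    qed
  qed
  have "?P = distr (?P \<Otimes>\<^sub>M ?P) ?P (shift_merge I K s)"
  proof (rule measure_eqI_PiM_infinite)
    fix A J assume J: "finite J" "J \<subseteq> I" and A: "\<And>i. i \<in> J \<Longrightarrow> A i \<in> sets (M i)"
    let ?J1 = "J \<inter> K" and ?J2 = "s ` (J - K)"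
    \<comment> \<open>The second cylinder lives on the relabelled coordinates \<open>s j\<close>;
      the inverse recovers which \<open>A j\<close> constrains each of them.\<close>
    let ?s' = "the_inv_into (J - K) s"
    have inj: "inj_on s (J - K)" using s(1) J(2) by (auto intro: inj_on_subset)
    let ?E1 = "prod_emb I M ?J1 (Pi\<^sub>E ?J1 A)"
    let ?E2 = "prod_emb I M ?J2 (Pi\<^sub>E ?J2 (\<lambda>i. A (?s' i)))"
    have A2: "A (?s' i) \<in> sets (M i)" if "i \<in> ?J2" for i
      using that A J(2) s(3) by (auto simp: the_inv_into_f_f[OF inj])
    have J2: "finite ?J2" "?J2 \<subseteq> I" using J s(2) by auto
    have E: "?E1 \<in> sets ?P" "?E2 \<in> sets ?P"
      using J A A2 J2 by (auto intro!: sets_PiM_I)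
    have J2': "(\<forall>i\<in>?J2. \<omega> i \<in> A (?s' i)) \<longleftrightarrow> (\<forall>j\<in>J-K. \<omega> (s j) \<in> A j)" for \<omega>
      by (auto simp: the_inv_into_f_f[OF inj])
    have eq: "shift_merge I K s -` prod_emb I M J (Pi\<^sub>E J A) \<inter> space (?P \<Otimes>\<^sub>M ?P) = ?E1 \<times> ?E2"
    proof (rule set_eqI, unfold split_paired_all, rule iffI)
      fix \<omega> \<omega>'
      assume "(\<omega>, \<omega>') \<in> shift_merge I K s -` prod_emb I M J (Pi\<^sub>E J A) \<inter> space (?P \<Otimes>\<^sub>M ?P)"
      then have *: "shift_merge I K s (\<omega>, \<omega>') \<in> prod_emb I M J (Pi\<^sub>E J A)"
        and sp: "(\<omega>, \<omega>') \<in> space (?P \<Otimes>\<^sub>M ?P)" by auto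
      have val: "shift_merge I K s (\<omega>, \<omega>') j \<in> A j" if "j \<in> J" for j
        using * that by (auto simp: prod_emb_def PiE_iff dest: restrict_apply')
      have 1: "\<omega> \<in> ?E1"
        using sp J(2) val by (force simp: prod_emb_def PiE_iff space_pair_measure space_PiM shift_merge_def)
      have "\<forall>j\<in>J-K. \<omega>' (s j) \<in> A j"
        using J(2) val by (force simp: shift_merge_def)
      then have "\<omega>' \<in> ?E2"
        unfolding J2'[symmetric] using sp
        by (auto simp: prod_emb_def PiE_iff space_pair_measure space_PiM)
      with 1 show "(\<omega>, \<omega>') \<in> ?E1 \<times> ?E2" by blast
    next
      fix \<omega> \<omega>' assume "(\<omega>, \<omega>') \<in> ?E1 \<times> ?E2"
      then have w: "\<omega> \<in> ?E1" "\<omega>' \<in> ?E2" by auto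
      then have sp: "(\<omega>, \<omega>') \<in> space (?P \<Otimes>\<^sub>M ?P)"
        by (simp add: prod_emb_def space_pair_measure space_PiM)
      have "shift_merge I K s (\<omega>, \<omega>') \<in> space ?P"
        using measurable_space[OF f sp] .
      moreover have 1: "\<forall>j\<in>?J1. \<omega> j \<in> A j"
        using w(1) by (auto simp: prod_emb_def PiE_iff dest: restrict_apply')
      moreover have "\<forall>j\<in>?J2. \<omega>' j \<in> A (?s' j)"
        using w(2) by (auto simp: prod_emb_def PiE_iff dest: restrict_apply')
      then have "\<forall>j\<in>J-K. \<omega>' (s j) \<in> A j" unfolding J2' .
      with 1 have "\<forall>j\<in>J. shift_merge I K s (\<omega>, \<omega>') j \<in> A j"
        using J(2) by (auto simp: shift_merge_def)
      ultimately have "shift_merge I K s (\<omega>, \<omega>') \<in> prod_emb I M J (Pi\<^sub>E J A)"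
        by (auto simp: prod_emb_def PiE_iff space_PiM)
      with sp show "(\<omega>, \<omega>') \<in> shift_merge I K s -` prod_emb I M J (Pi\<^sub>E J A) \<inter> space (?P \<Otimes>\<^sub>M ?P)"
        by simp
    qed
    have "emeasure (distr (?P \<Otimes>\<^sub>M ?P) ?P (shift_merge I K s)) (prod_emb I M J (Pi\<^sub>E J A)) =
        emeasure (?P \<Otimes>\<^sub>M ?P) (?E1 \<times> ?E2)"
      using J A by (subst emeasure_distr) (auto simp: eq intro!: sets_PiM_I)
    also have "\<dots> = emeasure ?P ?E1 * emeasure ?P ?E2"
      using E by (rule P.emeasure_pair_measure_Times)
    also have "emeasure ?P ?E1 = (\<Prod>i\<in>?J1. emeasure (M i) (A i))"
      using J A by (intro emeasure_PiM_emb M) auto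
    also have "emeasure ?P ?E2 = (\<Prod>i\<in>?J2. emeasure (M i) (A (?s' i)))"
      using J2 A2 by (intro emeasure_PiM_emb M) auto
    also have "\<dots> = (\<Prod>j\<in>J - K. emeasure (M j) (A j))"
      using J s(3) by (subst prod.reindex[OF inj])
        (auto intro!: prod.cong simp: the_inv_into_f_f[OF inj])
    also have "(\<Prod>i\<in>?J1. emeasure (M i) (A i)) * \<dots> = (\<Prod>i\<in>J. emeasure (M i) (A i))"
      using J by (subst prod.Int_Diff[of J _ K]) auto
    also have "\<dots> = emeasure ?P (prod_emb I M J (Pi\<^sub>E J A))"
      using J A by (intro emeasure_PiM_emb[symmetric] M) auto
    finally show "emeasure ?P (prod_emb I M J (Pi\<^sub>E J A)) =
        emeasure (distr (?P \<Otimes>\<^sub>M ?P) ?P (shift_merge I K s)) (prod_emb I M J (Pi\<^sub>E J A))" by simp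
  qed (auto intro: P.finite_measure_axioms)
  with f show ?thesis by (simp add: combines_def)
qed

section \<open>Sampling laws and sections of almost sure statements\<close>

lemma prob_space_uniform_on:
  assumes "sampled_space mu X"
  shows "prob_space (uniform_on mu X)"
  using assms unfolding sampled_space_def uniform_on_def
  by (intro prob_space_uniform_measure) auto

lemma AE_pair_measure_sections:
  assumes "prob_space M" "prob_space N" "AE w in M \<Otimes>\<^sub>M N. P w"
  shows "AE x in M. AE y in N. P (x, y)"
proof -
  interpret M: prob_space M by fact
  interpret N: prob_space N by fact
  interpret MN: pair_prob_space M N ..
  show ?thesis by (rule MN.AE_pair) fact
qed

text \<open>The draws list the free configurations before the goal configurations and the seeds, but
  they have to be chosen after them.\<close>

lemma AE_pair_measure_swap:
  assumes "prob_space M" "prob_space N" "AE w in M \<Otimes>\<^sub>M N. P w"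
  shows "AE y in N. AE x in M. P (x, y)"
proof -
  interpret M: prob_space M by fact
  interpret N: prob_space N by fact
  interpret MN: pair_prob_space M N ..
  have "AE w in N \<Otimes>\<^sub>M M. P (case w of (y, x) \<Rightarrow> (x, y))"
    using assms(3)
    by (intro AE_distrD[where M' = "M \<Otimes>\<^sub>M N" and f = "\<lambda>(y, x). (x, y)", OF measurable_pair_swap'])
      (simp only: MN.distr_pair_swap[symmetric])
  from AE_pair_measure_sections[OF assms(2,1) this] show ?thesis by simp
qed

text \<open>Nonmeasurable sets have \<open>emeasure\<close> 0, so positivity of the relative measure
  already yields measurability. The parameter sets of a robustly feasible problem are given by such
  positivity.\<close>

lemma uniform_on_pos:
  assumes X: "sampled_space mu X" and E: "0 < rel_measure mu E X"
  shows "E \<in> sets (uniform_on mu X)" "0 < emeasure (uniform_on mu X) E"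
proof -
  have "0 < measure (mu X) E"
    using E unfolding rel_measure_def by (metis divide_eq_0_iff less_irrefl measure_nonneg order_less_le)
  then have pos: "0 < emeasure (mu X) E" by (auto simp: measure_def enn2real_positive_iff)
  then have sets: "E \<in> sets (mu X)" using emeasure_notin_sets[of E "mu X"] by (metis less_irrefl)
  then show "E \<in> sets (uniform_on mu X)" by (simp add: uniform_on_def)
  have XE: "X \<inter> E = E" and X': "X \<in> sets (mu X)"
    using X sets.sets_into_space[OF sets] sets.top[of "mu X"] by (auto simp: sampled_space_def)
  show "0 < emeasure (uniform_on mu X) E"
    unfolding uniform_on_def using pos X sets X'
    by (simp add: emeasure_uniform_measure XE ennreal_zero_less_divide sampled_space_def)
qed

lemma emeasure_lebesgue_on_open_pos:
  fixes B C :: "'c::euclidean_space set"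
  assumes "open B" "B \<noteq> {}" "B \<subseteq> C" "C \<in> sets lebesgue"
  shows "B \<in> sets (lebesgue_on C)" "0 < emeasure (lebesgue_on C) B"
proof -
  have B: "B \<in> sets lebesgue" using assms(1) by simp
  then show "B \<in> sets (lebesgue_on C)" using assms by (simp add: sets_restrict_space_iff)
  have "\<not> negligible B" using open_not_negligible assms by blast
  then have "emeasure lebesgue B \<noteq> 0"
    using B by (auto simp: negligible_iff_null_sets null_sets_def)
  then show "0 < emeasure (lebesgue_on C) B"
    using assms by (simp add: emeasure_restrict_space zero_less_iff_neq_zero)
qed

section \<open>Series and moments\<close>

text \<open>With \<open>s\<close> the square root of \<rho>, one factor \<open>s ^ n\<close> absorbs
  the polynomial into a bounded sequence and the other is a geometric majorant.\<close>

lemma summable_power_times_geometric: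
  fixes \<rho> :: real
  assumes "0 < \<rho>" "\<rho> < 1"
  shows "summable (\<lambda>n. real n ^ a * \<rho> ^ n)"
proof -
  define s where "s = sqrt \<rho>"
  have s: "0 < s" "s < 1" "\<rho> = s * s"
    using assms by (auto simp: s_def)
  have "(\<lambda>n. real n ^ a * s ^ n) \<longlonglongrightarrow> 0"
  proof (cases "a = 0")
    case True
    then show ?thesis using s by (simp add: LIMSEQ_power_zero)
  next
    case False
    \<comment> \<open>The root turns the claim into the \<open>a\<close>-th power of the limit of
      \<open>n * y ^ n\<close>.\<close>
    define y where "y = root a s"
    have y: "0 < y" "y < 1" "y ^ a = s" using s False by (auto simp: y_def)
    have "(\<lambda>n. (real n * y ^ n) ^ a) \<longlonglongrightarrow> 0 ^ a"
      using y by (intro tendsto_power powser_times_n_limit_0) auto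
    moreover have "(real n * y ^ n) ^ a = real n ^ a * s ^ n" for n
      by (simp add: power_mult_distrib y(3)[symmetric] power_mult[symmetric] mult.commute)
    ultimately show ?thesis using False by (simp add: power_0_left)
  qed
  then have "Bseq (\<lambda>n. real n ^ a * s ^ n)" by (intro convergent_imp_Bseq convergentI)
  then obtain B where B: "\<And>n. norm (real n ^ a * s ^ n) \<le> B" unfolding Bseq_def by blast
  show ?thesis
  proof (rule summable_comparison_test')
    show "summable (\<lambda>n. B * s ^ n)" using s by (intro summable_mult summable_geometric) simp
    show "norm (real n ^ a * \<rho> ^ n) \<le> B * s ^ n" for n
    proof -
      have "norm (real n ^ a * \<rho> ^ n) = norm (real n ^ a * s ^ n) * s ^ n"
        using s by (simp add: power_mult_distrib abs_mult)
      also have "\<dots> \<le> B * s ^ n" using B s by (intro mult_right_mono) auto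
      finally show ?thesis .
    qed
  qed
qed

text \<open>Every full block of \<open>N\<close> indices contributes a factor at most
  \<open>r\<close>. The incomplete block is bounded by 1, and its loss is repaid by the constant
  \<open>1 / r\<close>.\<close>

lemma submultiplicative_geometric:
  fixes u :: "nat \<Rightarrow> real"
  assumes u: "\<And>n. 0 \<le> u n" "\<And>n. u n \<le> 1"
    and sub: "\<And>n m. n \<ge> 1 \<Longrightarrow> m \<ge> 1 \<Longrightarrow> u (n + m) \<le> u n * u m"
    and N: "N \<ge> 1" "u N < 1"
  obtains C \<rho> where "0 < \<rho>" "\<rho> < 1" "\<And>n. n \<ge> 1 \<Longrightarrow> u n \<le> C * \<rho> ^ n"
proof -
  \<comment> \<open>The maximum keeps \<open>r\<close> positive even if \<open>u N = 0\<close>, as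
    needed for the logarithmic form of the power and for the division by \<open>r\<close>.\<close>
  define r where "r = max (u N) (1 / 2)"
  have r: "0 < r" "r < 1" "u N \<le> r" using N by (auto simp: r_def)
  define \<rho> where "\<rho> = r powr (1 / real N)"
  have \<rho>: "0 < \<rho>" using r by (simp add: \<rho>_def)
  have \<rho>1: "\<rho> < 1" unfolding \<rho>_def using r N powr_less_mono2[of "1 / real N" r 1] by simp
  have blocks: "u (q * N + m) \<le> r ^ q" if m: "m \<ge> 1" for q m
  proof (induction q)
    case 0
    then show ?case using u by simp
  next
    case (Suc q)
    have "u (Suc q * N + m) = u (N + (q * N + m))" by (simp add: algebra_simps)
    also have "\<dots> \<le> u N * u (q * N + m)" using N m by (intro sub) auto
    also have "\<dots> \<le> r * r ^ q" using r Suc u by (intro mult_mono) auto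
    finally show ?case by simp
  qed
  show thesis
  proof (rule that[OF \<rho> \<rho>1, of "1 / r"])
    fix n :: nat assume n: "n \<ge> 1"
    \<comment> \<open>Dividing \<open>n - 1\<close> instead of \<open>n\<close> leaves a last block
      of length between 1 and \<open>N\<close>: submultiplicativity is given for positive indices
      only.\<close>
    define q where "q = (n - 1) div N"
    have dm: "n = q * N + ((n - 1) mod N + 1)" "(n - 1) mod N < N"
      using n N by (auto simp: q_def)
    have "n \<le> (q + 1) * N" using dm by (simp add: algebra_simps)
    then have "real n \<le> (real q + 1) * real N"
      by (metis of_nat_1 of_nat_add of_nat_le_iff of_nat_mult)
    then have le: "real n / real N - 1 \<le> real q" using N by (simp add: field_simps)
    have "u n \<le> r ^ q" using blocks[of "(n - 1) mod N + 1" q] dm(1) by simp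
    also have "\<dots> = r powr real q" using r by (simp add: powr_realpow)
    also have "\<dots> \<le> r powr (real n / real N - 1)"
      using r le by (intro powr_mono') auto
    also have "\<dots> = (r powr (1 / real N)) powr real n / r"
      using r by (simp add: powr_diff powr_powr)
    also have "\<dots> = 1 / r * \<rho> ^ n"
      using \<rho> by (simp add: \<rho>_def[symmetric] powr_realpow)
    finally show "u n \<le> 1 / r * \<rho> ^ n" .
  qed
qed

text \<open>The second moment controls both integrals, by \<open>t \<le> 1 + t * t\<close> and, as
  the cross term is negative, \<open>(t - m)\<^sup>2 \<le> t * t + m * m\<close>. Where
  \<open>T\<close> is infinite, both right-hand sides are infinite, whatever value
  \<open>enn2real\<close> takes there.\<close>

lemma mean_var_finite:
  assumes "prob_space M" and [measurable]: "T \<in> borel_measurable M"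
    and T2: "(\<integral>\<^sup>+ w. T w * T w \<partial>M) < \<infinity>"
  shows "mean M T < \<infinity> \<and> var M T < \<infinity>"
proof
  interpret prob_space M by fact
  have "mean M T \<le> (\<integral>\<^sup>+ w. 1 + T w * T w \<partial>M)"
    unfolding mean_def
  proof (rule nn_integral_mono)
    fix w
    show "T w \<le> 1 + T w * T w"
    proof (cases "T w")
      case (real t)
      have "t \<le> 1 + t * t" using zero_le_square[of "t - 1 / 2"] by (simp add: algebra_simps)
      then show ?thesis using real by (simp add: ennreal_mult[symmetric] flip: ennreal_1 ennreal_plus)
    qed (simp add: ennreal_top_mult)
  qed
  also have "\<dots> = 1 + (\<integral>\<^sup>+ w. T w * T w \<partial>M)"
    by (subst nn_integral_add) (simp_all add: emeasure_space_1)
  also have "\<dots> < \<infinity>" using T2 by simp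
  finally show "mean M T < \<infinity>" .
  define m where "m = enn2real (mean M T)"
  have m: "0 \<le> m" by (simp add: m_def)
  have "var M T \<le> (\<integral>\<^sup>+ w. T w * T w + ennreal (m * m) \<partial>M)"
    unfolding var_def m_def[symmetric]
  proof (rule nn_integral_mono)
    fix w
    show "ennreal ((enn2real (T w) - m)\<^sup>2) \<le> T w * T w + ennreal (m * m)"
    proof (cases "T w")
      case (real t)
      have "(t - m)\<^sup>2 \<le> t * t + m * m" using real m by (simp add: power2_eq_square algebra_simps)
      then show ?thesis using real m by (simp add: ennreal_mult[symmetric] flip: ennreal_plus)
    qed (simp add: ennreal_top_mult)
  qed
  also have "\<dots> = (\<integral>\<^sup>+ w. T w * T w \<partial>M) + ennreal (m * m)"
    by (subst nn_integral_add) (simp_all add: emeasure_space_1)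
  also have "\<dots> < \<infinity>" using T2 by simp
  finally show "var M T < \<infinity>" .
qed

section \<open>Polynomial growth\<close>

text \<open>\<open>K\<close> and \<open>d\<close> are chosen before the outcome \<open>w\<close>, so
  the cost of an iteration has a deterministic bound and only the number of iterations is random.
  For \<open>n \<ge> 1\<close> exponents may be enlarged freely, which lets bounds be added.\<close>

definition poly_card :: "('a \<Rightarrow> nat \<Rightarrow> 'b set) \<Rightarrow> bool" where
  "poly_card X \<longleftrightarrow> (\<exists>K d. \<forall>w. \<forall>n\<ge>1. finite (X w n) \<and> card (X w n) \<le> K * n ^ d)"

lemma poly_cardI:
  assumes "\<And>w n. n \<ge> 1 \<Longrightarrow> finite (X w n) \<and> card (X w n) \<le> K * n ^ d"
  shows "poly_card X"
  using assms unfolding poly_card_def by blast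

lemma poly_card_const: "finite A \<Longrightarrow> poly_card (\<lambda>w n. A)"
  by (rule poly_cardI[where K = "card A" and d = 0]) simp

lemma poly_card_iterations: "poly_card (\<lambda>w n. {1..n})"
  by (rule poly_cardI[where K = 1 and d = 1]) simp

lemma poly_card_surj:
  assumes "poly_card X" "\<And>w n. Y w n \<subseteq> f w n ` X w n"
  shows "poly_card Y"
proof -
  from assms(1) obtain K d where X: "\<And>w n. n \<ge> 1 \<Longrightarrow> finite (X w n) \<and> card (X w n) \<le> K * n ^ d"
    unfolding poly_card_def by blast
  show ?thesis
  proof (rule poly_cardI[where K = K and d = d])
    fix w and n :: nat assume n: "n \<ge> 1"
    then have "finite (X w n)" using X by blast
    then have "finite (Y w n)" "card (Y w n) \<le> card (X w n)"
      using finite_surj[OF _ assms(2)] surj_card_le[OF _ assms(2)] by blast+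
    then show "finite (Y w n) \<and> card (Y w n) \<le> K * n ^ d"
      using X[OF n, of w] by linarith
  qed
qed

lemma poly_card_subset:
  assumes "poly_card X" "\<And>w n. Y w n \<subseteq> X w n"
  shows "poly_card Y"
  by (rule poly_card_surj[where f = "\<lambda>_ _ x. x", OF assms(1)]) (use assms(2) in simp)

lemma poly_card_image: "poly_card X \<Longrightarrow> poly_card (\<lambda>w n. f w n ` X w n)"
  by (rule poly_card_surj[where X = X and f = f]) auto

lemma poly_card_Times:
  assumes "poly_card X" "poly_card Y"
  shows "poly_card (\<lambda>w n. X w n \<times> Y w n)"
proof -
  from assms obtain K d K' d' where
    X: "\<And>w n. n \<ge> 1 \<Longrightarrow> finite (X w n) \<and> card (X w n) \<le> K * n ^ d" and
    Y: "\<And>w n. n \<ge> 1 \<Longrightarrow> finite (Y w n) \<and> card (Y w n) \<le> K' * n ^ d'"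
    unfolding poly_card_def by metis
  show ?thesis
  proof (rule poly_cardI[where K = "K * K'" and d = "d + d'"])
    fix w and n :: nat assume n: "n \<ge> 1"
    have "card (X w n \<times> Y w n) \<le> (K * n ^ d) * (K' * n ^ d')"
      unfolding card_cartesian_product using X[OF n] Y[OF n] by (intro mult_mono) auto
    then show "finite (X w n \<times> Y w n) \<and> card (X w n \<times> Y w n) \<le> K * K' * n ^ (d + d')"
      using X[OF n] Y[OF n] by (simp add: power_add mult_ac)
  qed
qed

lemma poly_card_Un:
  assumes "poly_card X" "poly_card Y"
  shows "poly_card (\<lambda>w n. X w n \<union> Y w n)"
proof -
  from assms obtain K d K' d' where
    X: "\<And>w n. n \<ge> 1 \<Longrightarrow> finite (X w n) \<and> card (X w n) \<le> K * n ^ d" and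
    Y: "\<And>w n. n \<ge> 1 \<Longrightarrow> finite (Y w n) \<and> card (Y w n) \<le> K' * n ^ d'"
    unfolding poly_card_def by metis
  show ?thesis
  proof (rule poly_cardI[where K = "K + K'" and d = "d + d'"])
    fix w and n :: nat assume n: "n \<ge> 1"
    have "card (X w n \<union> Y w n) \<le> K * n ^ d + K' * n ^ d'"
      using X[OF n, of w] Y[OF n, of w] card_Un_le[of "X w n" "Y w n"] by linarith
    also have "\<dots> \<le> K * n ^ (d + d') + K' * n ^ (d + d')"
      using n by (intro add_mono mult_left_mono power_increasing) auto
    finally show "finite (X w n \<union> Y w n) \<and> card (X w n \<union> Y w n) \<le> (K + K') * n ^ (d + d')"
      using X[OF n] Y[OF n] by (simp add: algebra_simps)
  qed
qed

lemma poly_card_UN: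
  assumes "finite I" "\<And>i. i \<in> I \<Longrightarrow> poly_card (X i)"
  shows "poly_card (\<lambda>w n. \<Union>i\<in>I. X i w n)"
  using assms
proof (induction I rule: finite_induct)
  case empty
  then show ?case using poly_card_const[of "{}"] by simp
next
  case (insert i I)
  then show ?case by (simp add: poly_card_Un)
qed

lemma poly_card_UN_iterations:
  assumes "poly_card X"
  shows "poly_card (\<lambda>w n. \<Union>k\<in>{1..n}. X w k)"
proof -
  from assms obtain K d where X: "\<And>w n. n \<ge> 1 \<Longrightarrow> finite (X w n) \<and> card (X w n) \<le> K * n ^ d"
    unfolding poly_card_def by blast
  show ?thesis
  proof (rule poly_cardI[where K = K and d = "Suc d"])
    fix w and n :: nat
    have "card (\<Union>k\<in>{1..n}. X w k) \<le> (\<Sum>k\<in>{1..n}. card (X w k))"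
      by (rule card_UN_le) simp
    also have "\<dots> \<le> (\<Sum>k\<in>{1..n}. K * n ^ d)"
    proof (rule sum_mono)
      fix k assume k: "k \<in> {1..n}"
      then have "card (X w k) \<le> K * k ^ d" using X by simp
      also have "\<dots> \<le> K * n ^ d" using k by (intro mult_left_mono power_mono) auto
      finally show "card (X w k) \<le> K * n ^ d" .
    qed
    finally show "finite (\<Union>k\<in>{1..n}. X w k) \<and> card (\<Union>k\<in>{1..n}. X w k) \<le> K * n ^ Suc d"
      using X by (simp add: mult_ac)
  qed
qed

text \<open>The exponent \<open>CARD('i)\<close> does not grow with \<open>n\<close>. Applied to
  assignments of poses to the finitely many objects, this keeps the number of search states
  polynomial.\<close>

lemma poly_card_functions:
  assumes "poly_card X"
  shows "poly_card (\<lambda>w n. {f :: 'i::finite \<Rightarrow> 'b. \<forall>i. f i \<in> X w n})"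
proof -
  from assms obtain K d where X: "\<And>w n. n \<ge> 1 \<Longrightarrow> finite (X w n) \<and> card (X w n) \<le> K * n ^ d"
    unfolding poly_card_def by blast
  show ?thesis
  proof (rule poly_cardI[where K = "K ^ CARD('i)" and d = "d * CARD('i)"])
    fix w and n :: nat assume n: "n \<ge> 1"
    have eq: "{f :: 'i \<Rightarrow> 'b. \<forall>i. f i \<in> X w n} = PiE UNIV (\<lambda>_. X w n)" by auto
    have "card (X w n) ^ CARD('i) \<le> (K * n ^ d) ^ CARD('i)"
      using X[OF n] by (intro power_mono) auto
    then show "finite {f :: 'i \<Rightarrow> 'b. \<forall>i. f i \<in> X w n} \<and>
        card {f :: 'i \<Rightarrow> 'b. \<forall>i. f i \<in> X w n} \<le> K ^ CARD('i) * n ^ (d * CARD('i))"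
      unfolding eq using X[OF n]
      by (simp add: card_PiE finite_PiE power_mult_distrib power_mult)
  qed
qed

text \<open>Values are counted through their sources, of which there are 2n + 1; repeated draws only
  lower the count.\<close>

lemma poly_card_samples: "poly_card (\<lambda>w n. samples (f w) n)"
proof (rule poly_card_surj[where f = "\<lambda>w n. the \<circ> f w"])
  show "poly_card (\<lambda>(w::'a) n. {Initial} \<union> (Uniform ` {1..n} \<union> Goal ` {1..n}))"
    by (intro poly_card_Un poly_card_image poly_card_const poly_card_iterations) simp
  show "samples (f w) n \<subseteq> (the \<circ> f w) ` ({Initial} \<union> (Uniform ` {1..n} \<union> Goal ` {1..n}))" for w n
  proof
    fix v assume "v \<in> samples (f w) n"
    then obtain s where "f w s = Some v" "s \<in> {Initial} \<union> (Uniform ` {1..n} \<union> Goal ` {1..n})"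
      by (auto simp: samples_def)
    then show "v \<in> (the \<circ> f w) ` ({Initial} \<union> (Uniform ` {1..n} \<union> Goal ` {1..n}))"
      by (intro image_eqI[of _ _ s]) simp_all
  qed
qed

section \<open>Sources of samples\<close>

text \<open>The place of a source after \<open>m\<close> iterations have been put in front of its
  run. The initial value is common to both runs and does not move.\<close>

primrec shift_source :: "nat \<Rightarrow> source \<Rightarrow> source" where
  "shift_source m Initial = Initial"
| "shift_source m (Uniform k) = Uniform (k + m)"
| "shift_source m (Goal k) = Goal (k + m)"

definition sources :: "nat \<Rightarrow> source set" where
  "sources n = {Initial} \<union> Uniform ` {1..n} \<union> Goal ` {1..n}"

lemma in_sources [simp]:
  "Initial \<in> sources n" "Uniform k \<in> sources n \<longleftrightarrow> k \<in> {1..n}" "Goal k \<in> sources n \<longleftrightarrow> k \<in> {1..n}"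
  by (auto simp: sources_def)

lemma samples_shift:
  assumes "\<And>s. s \<in> sources n \<Longrightarrow> f' (shift_source m s) = f s" "n + m \<le> n'"
  shows "samples f n \<subseteq> samples f' n'"
proof
  fix v assume "v \<in> samples f n"
  then consider "f Initial = Some v"
    | k where "k \<in> {1..n}" "f (Uniform k) = Some v \<or> f (Goal k) = Some v"
    by (auto simp: samples_def)
  then show "v \<in> samples f' n'"
  proof cases
    case 1
    then show ?thesis using assms(1)[of Initial] by (simp add: samples_def)
  next
    case 2
    then have "f' (Uniform (k + m)) = Some v \<or> f' (Goal (k + m)) = Some v"
      using assms(1)[of "Uniform k"] assms(1)[of "Goal k"] by auto
    moreover have "k + m \<in> {1..n'}" using 2(1) assms(2) by auto
    ultimately show ?thesis unfolding samples_def by blast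
  qed
qed

text \<open>As addresses prefer the latest source, earlier draws of the same element do not interfere.\<close>

lemma
  assumes f: "\<And>s. s \<in> sources n \<Longrightarrow> f' (shift_source m s) = f s" and v: "v \<in> samples f n"
  shows address_shift: "address f' (n + m) v = shift_source m (address f n v)"
    and address_in_sources: "address f n v \<in> sources n"
proof -
  have "address f' (n + m) v = shift_source m (address f n v) \<and> address f n v \<in> sources n"
  proof (cases "f Initial = Some v")
    case True
    then show ?thesis using f[of Initial] by (simp add: address_def)
  next
    case False
    let ?P = "\<lambda>f k. f (Uniform k) = Some v \<or> f (Goal k) = Some v"
    let ?K = "{k \<in> {1..n}. ?P f k}" and ?K' = "{k \<in> {1..n + m}. ?P f' k}"
    define k where "k = Max ?K"
    have "?K \<noteq> {}" using v False by (auto simp: samples_def)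
    then have k: "k \<in> ?K" unfolding k_def by (intro Max_in) auto
    have le: "j \<le> k" if "j \<in> ?K" for j unfolding k_def using that by (intro Max_ge) auto
    have P': "?P f' (j + m) \<longleftrightarrow> ?P f j" if "j \<in> {1..n}" for j
      using f[of "Uniform j"] f[of "Goal j"] that by simp
    \<comment> \<open>A hit of \<open>f'\<close> at an index up to \<open>m\<close> is below
      \<open>k + m\<close> anyway, and a later one is the shift of a hit of
      \<open>f\<close>.\<close>
    have M: "Max ?K' = k + m"
    proof (rule Max_eqI)
      show "k + m \<in> ?K'" using k P'[of k] by simp
      fix j assume j: "j \<in> ?K'"
      show "j \<le> k + m"
      proof (cases "j \<le> m")
        case True then show ?thesis by simp
      next
        case False
        then have "j - m \<in> {1..n}" "j = (j - m) + m" using j by auto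
        then have "j - m \<in> ?K" using P'[of "j - m"] j by auto
        from le[OF this] show ?thesis by linarith
      qed
    qed simp
    have f'Initial: "f' Initial \<noteq> Some v" using f[of Initial] False by simp
    have "address f n v = (if f (Uniform k) = Some v then Uniform k else Goal k)"
      using False by (simp only: address_def Let_def k_def if_False)
    moreover have "address f' (n + m) v =
        (if f' (Uniform (k + m)) = Some v then Uniform (k + m) else Goal (k + m))"
      using f'Initial by (simp only: address_def Let_def M if_False)
    ultimately show ?thesis
      using f[of "Uniform k"] k by auto
  qed
  then show "address f' (n + m) v = shift_source m (address f n v)" "address f n v \<in> sources n" by auto
qed

lemma sources_mono: "n \<le> n' \<Longrightarrow> sources n \<subseteq> sources n'"
  by (auto simp: sources_def)

section \<open>Robust motions\<close>

text \<open>Balls of radius \<delta>/4 are placed along the trajectory at distances below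
  \<delta>/4. Points in consecutive balls lie in one ball of radius \<delta>, which is convex and
  contained in \<open>Q\<close>, so any vertex set that hits all balls contains a polygonal path.
  The family is finite and depends on the motion only, hence can be fixed before the free
  configurations are drawn.\<close>

lemma robust_motion_net:
  assumes "robust_motion Q q q'"
  obtains \<B> where "finite \<B>" "\<And>B. B \<in> \<B> \<Longrightarrow> open B \<and> B \<noteq> {} \<and> B \<subseteq> Q"
    "\<And>V. \<lbrakk>q \<in> V; q' \<in> V; \<And>B. B \<in> \<B> \<Longrightarrow> V \<inter> B \<noteq> {}\<rbrakk> \<Longrightarrow>
       (q, q') \<in> {(x, y) \<in> V \<times> V. closed_segment x y \<subseteq> Q}\<^sup>*"
proof -
  obtain \<delta> \<tau> where \<delta>: "\<delta> > 0" and \<tau>: "path \<tau>" "path_image \<tau> \<subseteq> Q"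
    and clear: "\<And>x y. x \<in> path_image \<tau> \<Longrightarrow> y \<in> frontier Q \<Longrightarrow> \<delta> \<le> dist x y"
    and start: "\<And>y. y \<in> Q \<Longrightarrow> dist y (pathstart \<tau>) \<le> \<delta> / 2 \<Longrightarrow> closed_segment q y \<subseteq> Q"
    and finish: "\<And>y. y \<in> Q \<Longrightarrow> dist y (pathfinish \<tau>) \<le> \<delta> / 2 \<Longrightarrow> closed_segment y q' \<subseteq> Q"
    using assms unfolding robust_motion_def by blast
  \<comment> \<open>A ball that meets both \<open>Q\<close> and its complement meets the frontier,
    since it is connected; this contradicts the clearance.\<close>
  have ball: "ball x \<delta> \<subseteq> Q" if x: "x \<in> path_image \<tau>" for x
  proof (rule ccontr)
    assume "\<not> ball x \<delta> \<subseteq> Q"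
    moreover have "x \<in> ball x \<delta> \<inter> Q" using x \<tau>(2) \<delta> by auto
    ultimately have "ball x \<delta> \<inter> frontier Q \<noteq> {}"
      by (intro connected_Int_frontier connected_ball) blast+
    then show False using clear[OF x] by force
  qed
  have "uniformly_continuous_on {0..1} \<tau>"
    using \<tau>(1) by (intro compact_uniformly_continuous) (auto simp: path_def)
  then obtain d where d: "d > 0"
    and close: "\<And>s t. s \<in> {0..1} \<Longrightarrow> t \<in> {0..1} \<Longrightarrow> dist t s < d \<Longrightarrow> dist (\<tau> t) (\<tau> s) < \<delta> / 4"
    using \<delta> unfolding uniformly_continuous_on_def by (metis zero_less_divide_iff zero_less_numeral)
  \<comment> \<open>The spacing \<open>1 / L\<close> is below the modulus of continuity
    \<open>d\<close>, so neighbouring sample points of the trajectory are closer than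
    \<delta>/4.\<close>
  obtain L :: nat where L: "1 / d < real L" using reals_Archimedean2 by blast
  then have Lpos: "0 < real L" using d by (meson less_trans zero_less_divide_1_iff)
  define x where "x j = \<tau> (real j / real L)" for j
  have unit: "real j / real L \<in> {0..1}" if "j \<le> L" for j using that Lpos by auto
  have x_path: "x j \<in> path_image \<tau>" if "j \<le> L" for j
    using unit[OF that] by (auto simp: x_def path_image_def)
  have x_start: "x 0 = pathstart \<tau>" and x_finish: "x L = pathfinish \<tau>"
    using Lpos by (auto simp: x_def pathstart_def pathfinish_def)
  have x_close: "dist (x (Suc j)) (x j) < \<delta> / 4" if "Suc j \<le> L" for j
  proof -
    have "dist (real (Suc j) / real L) (real j / real L) = 1 / real L"
      using Lpos by (simp add: dist_real_def field_simps)
    also have "\<dots> < d" using L d Lpos by (simp add: field_simps)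
    finally show ?thesis unfolding x_def using unit that by (intro close) auto
  qed
  show thesis
  proof
    let ?\<B> = "(\<lambda>j. ball (x j) (\<delta> / 4)) ` {..L}"
    show "finite ?\<B>" by simp
    show "open B \<and> B \<noteq> {} \<and> B \<subseteq> Q" if B: "B \<in> ?\<B>" for B
    proof -
      from B obtain j where j: "j \<le> L" "B = ball (x j) (\<delta> / 4)"
        unfolding image_iff atMost_iff[symmetric] by blast
      have "B \<subseteq> ball (x j) \<delta>" unfolding j(2) using \<delta> by (intro subset_ball) simp
      then show ?thesis using j ball[OF x_path[OF j(1)]] \<delta> by auto
    qed
    fix V assume V: "q \<in> V" "q' \<in> V" and meets: "\<And>B. B \<in> ?\<B> \<Longrightarrow> V \<inter> B \<noteq> {}"
    have "\<forall>j\<in>{..L}. \<exists>y. y \<in> V \<inter> ball (x j) (\<delta> / 4)" using meets by blast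
    then obtain y where y: "\<And>j. j \<le> L \<Longrightarrow> y j \<in> V \<and> dist (x j) (y j) < \<delta> / 4"
      by (metis Int_iff atMost_iff mem_ball)
    have yQ: "y j \<in> Q" if "j \<le> L" for j
      using ball[OF x_path[OF that]] y[OF that] \<delta> by (auto simp: subset_iff)
    let ?R = "{(x, y) \<in> V \<times> V. closed_segment x y \<subseteq> Q}"
    have "(q, y j) \<in> ?R\<^sup>*" if "j \<le> L" for j
      using that
    proof (induction j)
      case 0
      have "closed_segment q (y 0) \<subseteq> Q"
        using y[OF 0] yQ[OF 0] \<delta> by (intro start) (auto simp: x_start[symmetric] dist_commute)
      then show ?case using V y[OF 0] by (intro r_into_rtrancl) simp
    next
      case (Suc j)
      have "dist (x j) (y (Suc j)) \<le> dist (x j) (x (Suc j)) + dist (x (Suc j)) (y (Suc j))"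
        by (rule dist_triangle)
      then have "y (Suc j) \<in> ball (x j) \<delta>"
        using y[OF Suc.prems] x_close[OF Suc.prems] \<delta> by (simp add: dist_commute)
      moreover have "y j \<in> ball (x j) \<delta>" using y[of j] Suc.prems \<delta> by simp
      ultimately have "closed_segment (y j) (y (Suc j)) \<subseteq> ball (x j) \<delta>"
        by (intro closed_segment_subset) auto
      then have "closed_segment (y j) (y (Suc j)) \<subseteq> Q"
        using ball[OF x_path[of j]] Suc.prems by auto
      then have "(y j, y (Suc j)) \<in> ?R" using y[of j] y[of "Suc j"] Suc.prems by simp
      with Suc show ?case by (meson Suc_leD rtrancl.rtrancl_into_rtrancl)
    qed
    from this[of L] have "(q, y L) \<in> ?R\<^sup>*" by simp
    moreover have "closed_segment (y L) q' \<subseteq> Q"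
      using y[of L] yQ[of L] \<delta> by (intro finish) (auto simp: x_finish[symmetric] dist_commute)
    then have "(y L, q') \<in> ?R" using V y[of L] by simp
    ultimately show "(q, q') \<in> ?R\<^sup>*" by (rule rtrancl.rtrancl_into_rtrancl)
  qed
qed

text \<open>A pick (first case) and a place (second case) are treated together, because both happen
  at a configuration solving inverse kinematics for the same \<open>p\<close> and
  \<open>g\<close>.\<close>

definition switch :: "('o, 'w) mode \<Rightarrow> ('o, 'w) mode \<Rightarrow> 'o \<Rightarrow> 'w transform \<Rightarrow> ('o, 'w) grasp \<Rightarrow> bool" where
  "switch \<omega> \<omega>' j p g \<longleftrightarrow> fst g = j \<and>
     (fst \<omega> = None \<and> snd \<omega> j = Some p \<and> \<omega>' = (Some g, (snd \<omega>)(j := None)) \<or>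
      fst \<omega> = Some g \<and> \<omega>' = (None, (snd \<omega>)(j := Some p)))"

lemma switch_cases:
  assumes "switch \<omega> \<omega>' j p g"
  shows "snd \<omega> j = Some p \<or> snd \<omega>' j = Some p" "fst \<omega> = Some g \<or> fst \<omega>' = Some g" "fst g = j"
  using assms unfolding switch_def by auto

context
  fixes D :: "('c::euclidean_space, 'o::finite, 'w::finite) ppm_domain"
    and \<P> :: "('c, 'o, 'w) ppm_problem"
    and S :: "('c, 'o, 'w, 'u) sampling"
begin

section \<open>Cost of an iteration\<close>

lemma poly_card_pose_samples: "poly_card (\<lambda>w n. pose_samples \<P> w i n)"
  unfolding pose_samples_def by (rule poly_card_samples)

lemma poly_card_grasp_samples: "poly_card (\<lambda>w n. grasp_samples D \<P> w i n)"
  unfolding grasp_samples_def by (rule poly_card_samples)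

lemma poly_card_ik_pairs: "poly_card (\<lambda>w n. ik_pairs D \<P> w i n)"
  by (rule poly_card_subset[OF poly_card_Times[OF poly_card_pose_samples[of i] poly_card_grasp_samples[of i]]])
    (auto simp: ik_pairs_def)

lemma poly_card_ik_samples: "poly_card (\<lambda>w n. ik_samples D \<P> S w i n)"
  unfolding ik_samples_def
  by (intro poly_card_UN_iterations poly_card_image poly_card_ik_pairs)

lemma poly_card_vertices: "poly_card (\<lambda>w n. vertices D \<P> S w n)"
  unfolding vertices_def
  by (intro poly_card_Un poly_card_UN poly_card_image poly_card_ik_samples poly_card_const
      poly_card_iterations) simp_all

lemma poly_card_actions: "poly_card (\<lambda>w n. actions D \<P> S w n)"
proof (rule poly_card_subset)
  let ?V = "\<lambda>w n. vertices D \<P> S w n \<times> vertices D \<P> S w n"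
  let ?H = "\<lambda>i w n. pose_samples \<P> w i n \<times> grasp_samples D \<P> w i n \<times> ik_samples D \<P> S w i n"
  let ?pick = "\<lambda>w n. \<Union>i. (\<lambda>(p, g, q). Pick i p g q) ` ?H i w n"
  let ?place = "\<lambda>w n. \<Union>i. (\<lambda>(p, g, q). Place i p g q) ` ?H i w n"
  show "poly_card (\<lambda>w n. (\<lambda>(q, q'). Move q q') ` ?V w n \<union> ?pick w n \<union> ?place w n)"
    by (intro poly_card_Un poly_card_UN poly_card_image poly_card_Times poly_card_vertices
        poly_card_pose_samples poly_card_grasp_samples poly_card_ik_samples) simp_all
  show "actions D \<P> S w n \<subseteq> (\<lambda>(q, q'). Move q q') ` ?V w n \<union> ?pick w n \<union> ?place w n" for w n
  proof
    fix a assume "a \<in> actions D \<P> S w n"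
    then consider q q' where "a = Move q q'" "(q, q') \<in> ?V w n"
      | i p g q where "a = Pick i p g q" "(p, g, q) \<in> ?H i w n"
      | i p g q where "a = Place i p g q" "(p, g, q) \<in> ?H i w n"
      unfolding actions_def by blast
    then show "a \<in> (\<lambda>(q, q'). Move q q') ` ?V w n \<union> ?pick w n \<union> ?place w n"
    proof cases
      case 1 then show ?thesis by (intro UnI1 image_eqI[of _ _ "(q, q')"]) simp_all
    next
      case 2 then show ?thesis
        by (intro UnI1 UnI2 UN_I[of i] image_eqI[of _ _ "(p, g, q)"]) simp_all
    next
      case 3 then show ?thesis
        by (intro UnI2 UN_I[of i] image_eqI[of _ _ "(p, g, q)"]) simp_all
    qed
  qed
qed

lemma poly_card_search_states: "poly_card (\<lambda>w n. search_states D \<P> S w n)"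
proof (rule poly_card_subset)
  let ?V = "\<lambda>w n. vertices D \<P> S w n"
  let ?G = "\<lambda>w n. {None} \<union> Some ` (\<Union>i. grasp_samples D \<P> w i n)"
  let ?F = "\<lambda>w n. {ps :: 'o \<Rightarrow> _. \<forall>i. ps i \<in> {None} \<union> Some ` (\<Union>i. pose_samples \<P> w i n)}"
  have F: "poly_card ?F"
    by (rule poly_card_functions, intro poly_card_Un poly_card_UN poly_card_image
        poly_card_pose_samples poly_card_const) simp_all
  show "poly_card (\<lambda>w n. ?V w n \<times> ?G w n \<times> ?F w n)"
    by (intro F poly_card_Un poly_card_UN poly_card_image poly_card_Times poly_card_vertices
        poly_card_grasp_samples poly_card_const) simp_all
  show "search_states D \<P> S w n \<subseteq> ?V w n \<times> ?G w n \<times> ?F w n" for w n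
  proof
    fix s assume s: "s \<in> search_states D \<P> S w n"
    obtain q g ps where [simp]: "s = (q, g, ps)" by (metis prod.exhaust)
    have "g \<in> ?G w n"
    proof (cases g)
      case (Some g')
      then have "g' \<in> grasp_samples D \<P> w (fst g') n" using s by (cases g') (simp add: search_states_def)
      then show ?thesis using Some by blast
    qed simp
    moreover have "ps i \<in> {None} \<union> Some ` (\<Union>i. pose_samples \<P> w i n)" for i
    proof (cases "ps i")
      case (Some p)
      then have "p \<in> pose_samples \<P> w i n" using s by (simp add: search_states_def)
      then show ?thesis using Some by blast
    qed simp
    ultimately show "s \<in> ?V w n \<times> ?G w n \<times> ?F w n"
      using s by (simp add: search_states_def)
  qed
qed

lemma elapsed_poly_bound:
  assumes "dijkstra_cost D \<P> S search_time"
  obtains K :: real and d where "K > 0"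
    "\<And>w n. w \<in> space (draw_space D \<P> S) \<Longrightarrow> n \<ge> 1 \<Longrightarrow>
       real (elapsed D \<P> search_time w n) \<le> K * real n ^ d"
proof -
  obtain C where C: "\<And>w n. w \<in> space (draw_space D \<P> S) \<Longrightarrow> n \<ge> 1 \<Longrightarrow>
      real (search_time w n) \<le> C * (1 + real (card (search_states D \<P> S w n)) * real (card (actions D \<P> S w n)) +
        real (card (search_states D \<P> S w n)) * ln (real (card (search_states D \<P> S w n))))"
    using assms unfolding dijkstra_cost_def Let_def by blast
  have "\<forall>i. \<exists>K d. \<forall>w :: ('c, 'o, 'w, 'u) draws. \<forall>n\<ge>1. card (ik_pairs D \<P> w i n) \<le> K * n ^ d"
    using poly_card_ik_pairs unfolding poly_card_def by blast
  then obtain Kp dp where P: "\<And>i (w :: ('c, 'o, 'w, 'u) draws) n. n \<ge> 1 \<Longrightarrow> card (ik_pairs D \<P> w i n) \<le> Kp i * n ^ dp i"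
    unfolding choice_iff by blast
  obtain Kv dv where V: "\<And>w n. n \<ge> 1 \<Longrightarrow> card (search_states D \<P> S w n) \<le> Kv * n ^ dv"
    using poly_card_search_states unfolding poly_card_def by blast
  obtain Ka da where A: "\<And>w n. n \<ge> 1 \<Longrightarrow> card (actions D \<P> S w n) \<le> Ka * n ^ da"
    using poly_card_actions unfolding poly_card_def by blast
  \<comment> \<open>A common exponent above every degree that occurs: those of the pair counts, of
    states times actions, and of states squared.\<close>
  define e where "e = (\<Sum>i\<in>UNIV. dp i) + (dv + da) + (dv + dv)"
  \<comment> \<open>Besides inverse kinematics, each object causes at most four draws, and two
    configurations are drawn in every iteration.\<close>
  define Ks where "Ks = real ((\<Sum>i\<in>(UNIV::'o set). 4 + Kp i) + 2)"
  define Kd where "Kd = \<bar>C\<bar> * (1 + real (Kv * Ka) + real (Kv * Kv))"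
  have step: "real (sampling_time D \<P> w n + search_time w n) \<le> (Ks + Kd) * real n ^ e"
    if w: "w \<in> space (draw_space D \<P> S)" and n: "n \<ge> 1" for w :: "('c, 'o, 'w, 'u) draws" and n
  proof -
    have pw: "n ^ a \<le> n ^ e" if "a \<le> e" for a using n that by (intro power_increasing) auto
    have pw': "real n ^ a \<le> real n ^ e" if "a \<le> e" for a
      using n that by (intro power_increasing) auto
    have one: "1 \<le> n ^ e" using n by simp
    have "sampling_time D \<P> w n \<le> (\<Sum>i\<in>(UNIV::'o set). (4 + Kp i) * n ^ e) + 2 * n ^ e"
      unfolding sampling_time_def
    proof (intro add_mono sum_mono)
      fix i :: 'o
      have "dp i \<le> e" unfolding e_def using member_le_sum[of i UNIV dp] by simp
      then have "Kp i * n ^ dp i \<le> Kp i * n ^ e" by (intro mult_left_mono pw) auto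
      then have "card (ik_pairs D \<P> w i n) \<le> Kp i * n ^ e" using P[OF n, of w i] by linarith
      then have "1 + of_bool (Option.these (goal_poses \<P> i) \<noteq> {}) + 1 + of_bool (goal_held D \<P> i) +
          card (ik_pairs D \<P> w i n) \<le> 4 + Kp i * n ^ e"
        by (auto simp: of_bool_def)
      also have "\<dots> \<le> (4 + Kp i) * n ^ e" using one by (simp add: algebra_simps)
      finally show "1 + of_bool (Option.these (goal_poses \<P> i) \<noteq> {}) + 1 + of_bool (goal_held D \<P> i) +
          card (ik_pairs D \<P> w i n) \<le> (4 + Kp i) * n ^ e" .
    qed (use one in auto)
    also have "\<dots> = ((\<Sum>i\<in>(UNIV::'o set). 4 + Kp i) + 2) * n ^ e"
      by (simp add: sum_distrib_right add_mult_distrib)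
    finally have "real (sampling_time D \<P> w n) \<le> real (((\<Sum>i\<in>(UNIV::'o set). 4 + Kp i) + 2) * n ^ e)"
      by (rule of_nat_mono)
    then have 1: "real (sampling_time D \<P> w n) \<le> Ks * real n ^ e"
      by (simp only: of_nat_mult of_nat_power Ks_def)
    define v where "v = real (card (search_states D \<P> S w n))"
    define a where "a = real (card (actions D \<P> S w n))"
    have v: "0 \<le> v" "v \<le> real Kv * real n ^ dv"
      using of_nat_mono[OF V[OF n, of w], where 'a = real] by (auto simp: v_def)
    have a: "0 \<le> a" "a \<le> real Ka * real n ^ da"
      using of_nat_mono[OF A[OF n, of w], where 'a = real] by (auto simp: a_def)
    have ln: "ln v \<le> v" using v(1) ln_bound[of v] by (cases "v = 0") auto
    have "real (search_time w n) \<le> C * (1 + v * a + v * ln v)"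
      unfolding v_def a_def by (rule C[OF w n])
    also have "\<dots> \<le> \<bar>C\<bar> * (1 + v * a + v * v)"
    proof -
      \<comment> \<open>\<open>C\<close> may be negative, so replacing it by its absolute value
        needs a nonnegative factor. \<open>v\<close> is a natural number and
        \<open>ln 0 = 0\<close>.\<close>
      have "0 \<le> ln v" unfolding v_def by (cases "card (search_states D \<P> S w n) = 0") auto
      then have "0 \<le> 1 + v * a + v * ln v" using v(1) a(1) by simp
      then have "C * (1 + v * a + v * ln v) \<le> \<bar>C\<bar> * (1 + v * a + v * ln v)"
        by (intro mult_right_mono) auto
      also have "\<dots> \<le> \<bar>C\<bar> * (1 + v * a + v * v)"
        using v(1) ln by (intro mult_left_mono add_left_mono) auto
      finally show ?thesis .
    qed
    also have "\<dots> \<le> \<bar>C\<bar> * (real n ^ e + real (Kv * Ka) * real n ^ e + real (Kv * Kv) * real n ^ e)"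
    proof (intro mult_left_mono add_mono)
      have "v * a \<le> (real Kv * real n ^ dv) * (real Ka * real n ^ da)"
        using v a by (intro mult_mono) auto
      also have "\<dots> = real (Kv * Ka) * real n ^ (dv + da)" by (simp add: power_add)
      also have "\<dots> \<le> real (Kv * Ka) * real n ^ e"
        by (intro mult_left_mono pw') (auto simp: e_def)
      finally show "v * a \<le> real (Kv * Ka) * real n ^ e" .
      have "v * v \<le> (real Kv * real n ^ dv) * (real Kv * real n ^ dv)"
        using v by (intro mult_mono) auto
      also have "\<dots> = real (Kv * Kv) * real n ^ (dv + dv)" by (simp add: power_add)
      also have "\<dots> \<le> real (Kv * Kv) * real n ^ e"
        by (intro mult_left_mono pw') (auto simp: e_def)
      finally show "v * v \<le> real (Kv * Kv) * real n ^ e" .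
      show "1 \<le> real n ^ e" using n by simp
    qed simp
    also have "\<dots> = Kd * real n ^ e" by (simp add: Kd_def algebra_simps)
    finally show ?thesis using 1 by (simp add: algebra_simps)
  qed
  have "2 \<le> Ks" unfolding Ks_def by (simp only: of_nat_add)
  moreover have "0 \<le> Kd" unfolding Kd_def by simp
  ultimately have Kpos: "0 < Ks + Kd" by linarith
  show thesis
  \<comment> \<open>The extra degree comes from adding \<open>n\<close> iterations, each bounded by
    the cost bound of the last one.\<close>
  proof (rule that[OF Kpos, of "Suc e"])
    fix w n assume w: "w \<in> space (draw_space D \<P> S)" and n: "(1::nat) \<le> n"
    have "real (elapsed D \<P> search_time w n) =
        (\<Sum>j=1..n. real (sampling_time D \<P> w j + search_time w j))"
      by (simp add: elapsed_def)
    also have "\<dots> \<le> (\<Sum>j=1..n. (Ks + Kd) * real n ^ e)"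
    proof (rule sum_mono)
      fix j assume j: "j \<in> {1..n}"
      have "(Ks + Kd) * real j ^ e \<le> (Ks + Kd) * real n ^ e"
        using j Kpos by (intro mult_left_mono power_mono) auto
      then show "real (sampling_time D \<P> w j + search_time w j) \<le> (Ks + Kd) * real n ^ e"
        using step[OF w, of j] j by auto
    qed
    finally show "real (elapsed D \<P> search_time w n) \<le> (Ks + Kd) * real n ^ Suc e"
      by (simp add: mult_ac)
  qed
qed

section \<open>Concatenation of runs\<close>

text \<open>A move asks only for the existence of a path in the roadmap, and pick and place only for
  available samples, so every plan survives an enlargement of the samples; the goal states do not
  refer to them.\<close>

lemma solved_mono:
  assumes V: "vertices D \<P> S w n \<subseteq> vertices D \<P> S w' n'"
    and P: "\<And>i. pose_samples \<P> w i n \<subseteq> pose_samples \<P> w' i n'"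
    and G: "\<And>i. grasp_samples D \<P> w i n \<subseteq> grasp_samples D \<P> w' i n'"
    and K: "\<And>i. ik_samples D \<P> S w i n \<subseteq> ik_samples D \<P> S w' i n'"
    and solved: "solved D \<P> S w n"
  shows "solved D \<P> S w' n'"
proof -
  have A: "actions D \<P> S w n \<subseteq> actions D \<P> S w' n'"
    unfolding actions_def using V P G K by blast
  have E: "edges D \<P> S w n \<subseteq> edges D \<P> S w' n'"
    unfolding edges_def using V by blast
  have step: "step D \<P> S w' n' a s s'" if "step D \<P> S w n a s s'" for a s s'
    using that
  proof cases
    case (1 q q' \<omega>)
    have "(q, q') \<in> {(x, y) \<in> edges D \<P> S w' n'. closed_segment x y \<subseteq> mode_confs D \<omega>}\<^sup>*"
      by (rule subsetD[OF rtrancl_mono 1(4)]) (use E in auto)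
    with 1 show ?thesis by (auto intro: step.intros)
  qed (auto intro: step.intros)
  have "{(s, s'). \<exists>a\<in>actions D \<P> S w n. step D \<P> S w n a s s'} \<subseteq>
      {(s, s'). \<exists>a\<in>actions D \<P> S w' n'. step D \<P> S w' n' a s s'}"
    using A step by blast
  from rtrancl_mono[OF this] show ?thesis
    using solved unfolding solved_def by blast
qed

text \<open>Iterations \<open>m + 1\<close>, ..., \<open>m + n\<close> of \<open>w'\<close> repeat
  the first \<open>n\<close> iterations of \<open>w\<close>. The comparison of sources covers the
  goal draws that exist for some objects only.\<close>

definition embeds ::
    "nat \<Rightarrow> nat \<Rightarrow> ('c, 'o, 'w, 'u) draws \<Rightarrow> ('c, 'o, 'w, 'u) draws \<Rightarrow> bool" where
  "embeds m n w w' \<longleftrightarrow>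
     (\<forall>i. \<forall>s\<in>sources n. pose_source \<P> w' i (shift_source m s) = pose_source \<P> w i s) \<and>
     (\<forall>i. \<forall>s\<in>sources n. grasp_source D \<P> w' i (shift_source m s) = grasp_source D \<P> w i s) \<and>
     (\<forall>k\<in>{1..n}. conf_draw w' (k + m) = conf_draw w k) \<and>
     (\<forall>k\<in>{1..n}. goal_conf_draw w' (k + m) = goal_conf_draw w k) \<and>
     (\<forall>k\<in>{1..n}. \<forall>i. \<forall>s\<in>sources n. \<forall>s'\<in>sources n.
        seed_draw w' (k + m, i, shift_source m s, shift_source m s') = seed_draw w (k, i, s, s'))"

text \<open>The delicate samples are those of inverse kinematics: \<open>w'\<close> may contain the
  same pose or grasp already among its first \<open>m\<close> iterations. The address in
  \<open>w'\<close> is nevertheless the shift of the address in \<open>w\<close>, so both runs read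
  the same seed.\<close>

lemma solved_embeds:
  assumes e: "embeds m n w w'" and n': "n + m \<le> n'" and solved: "solved D \<P> S w n"
  shows "solved D \<P> S w' n'"
proof (rule solved_mono[OF _ _ _ _ solved])
  have ps: "pose_source \<P> w' i (shift_source m s) = pose_source \<P> w i s"
    and gs: "grasp_source D \<P> w' i (shift_source m s) = grasp_source D \<P> w i s"
    if "s \<in> sources n" for i s
    using e that by (auto simp: embeds_def)
  have P: "pose_samples \<P> w i k \<subseteq> pose_samples \<P> w' i k'"
    and G: "grasp_samples D \<P> w i k \<subseteq> grasp_samples D \<P> w' i k'"
    if "k \<le> n" "k + m \<le> k'" for i k k'
    unfolding pose_samples_def grasp_samples_def
    using ps gs sources_mono[OF that(1)] by (intro samples_shift[OF _ that(2)]; blast)+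
  show "pose_samples \<P> w i n \<subseteq> pose_samples \<P> w' i n'" for i by (rule P) (use n' in auto)
  show "grasp_samples D \<P> w i n \<subseteq> grasp_samples D \<P> w' i n'" for i by (rule G) (use n' in auto)
  show K: "ik_samples D \<P> S w i n \<subseteq> ik_samples D \<P> S w' i n'" for i
  proof
    fix q assume "q \<in> ik_samples D \<P> S w i n"
    then obtain k p g where k: "k \<in> {1..n}" and pg: "(p, g) \<in> ik_pairs D \<P> w i k"
      and q: "q = ik S (ik_target p g) (seed_draw w
        (k, i, address (pose_source \<P> w i) k p, address (grasp_source D \<P> w i) k g))"
      unfolding ik_samples_def by auto
    have sub: "sources k \<subseteq> sources n" using k by (intro sources_mono) simp
    have p: "p \<in> samples (pose_source \<P> w i) k" and g: "g \<in> samples (grasp_source D \<P> w i) k"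
      using pg by (auto simp: ik_pairs_def pose_samples_def grasp_samples_def)
    have ap: "address (pose_source \<P> w' i) (k + m) p = shift_source m (address (pose_source \<P> w i) k p)"
      "address (pose_source \<P> w i) k p \<in> sources k"
      using address_shift[OF _ p] address_in_sources[OF _ p, of "pose_source \<P> w' i" m] ps sub by blast+
    have ag: "address (grasp_source D \<P> w' i) (k + m) g = shift_source m (address (grasp_source D \<P> w i) k g)"
      "address (grasp_source D \<P> w i) k g \<in> sources k"
      using address_shift[OF _ g] address_in_sources[OF _ g, of "grasp_source D \<P> w' i" m] gs sub by blast+
    have seed: "seed_draw w' (k + m, i, address (pose_source \<P> w' i) (k + m) p,
        address (grasp_source D \<P> w' i) (k + m) g) =
      seed_draw w (k, i, address (pose_source \<P> w i) k p, address (grasp_source D \<P> w i) k g)"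
      unfolding ap(1) ag(1) using e k ap(2) ag(2) sub unfolding embeds_def by blast
    have "(p, g) \<in> ik_pairs D \<P> w' i (k + m)"
      using pg P[of k "k + m" i] G[of k "k + m" i] k by (auto simp: ik_pairs_def)
    moreover have "k + m \<in> {1..n'}" using k n' by auto
    ultimately show "q \<in> ik_samples D \<P> S w' i n'"
      unfolding ik_samples_def q seed[symmetric] by force
  qed
  have C: "conf_draw w k \<in> conf_draw w' ` {1..n'}" "goal_conf_draw w k \<in> goal_conf_draw w' ` {1..n'}"
    if "k \<in> {1..n}" for k
    by (rule image_eqI[of _ _ "k + m"]; use e n' that in \<open>simp add: embeds_def\<close>)+
  show "vertices D \<P> S w n \<subseteq> vertices D \<P> S w' n'"
    unfolding vertices_def
    by (intro Un_mono UN_mono image_subsetI order_refl K C)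
qed

section \<open>The concatenated run and its law\<close>

abbreviation (input) obj_merge :: "nat \<Rightarrow> (nat \<times> 'o) set \<Rightarrow>
    (nat \<times> 'o \<Rightarrow> 'a) \<times> (nat \<times> 'o \<Rightarrow> 'a) \<Rightarrow> nat \<times> 'o \<Rightarrow> 'a" where
  "obj_merge N I \<equiv> shift_merge I {(k, i). k \<le> N} (\<lambda>(k, i). (k - N, i))"

text \<open>The seeds of the second run are stored at the addresses of its samples in the concatenated run.
  Addresses that mix iterations of the two runs are never used; they are filled from the first run so
  that the relabelling remains injective.\<close>

primrec old_source :: "nat \<Rightarrow> source \<Rightarrow> bool" where
  "old_source N Initial \<longleftrightarrow> False"
| "old_source N (Uniform k) \<longleftrightarrow> k \<le> N"
| "old_source N (Goal k) \<longleftrightarrow> k \<le> N"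

primrec unshift_source :: "nat \<Rightarrow> source \<Rightarrow> source" where
  "unshift_source m Initial = Initial"
| "unshift_source m (Uniform k) = Uniform (k - m)"
| "unshift_source m (Goal k) = Goal (k - m)"

definition old_seeds :: "nat \<Rightarrow> (nat \<times> 'o \<times> source \<times> source) set" where
  "old_seeds N = {(k, i, s, s'). k \<le> N \<or> old_source N s \<or> old_source N s'}"

text \<open>The nesting is that of \<open>draw_space\<close>, and the two goal components are merged
  over the index sets for which goal values are drawn.\<close>

definition concat_runs :: "nat \<Rightarrow> ('c, 'o, 'w, 'u) draws \<times> ('c, 'o, 'w, 'u) draws \<Rightarrow>
    ('c, 'o, 'w, 'u) draws" where
  "concat_runs N =
     pair_map (obj_merge N UNIV)
    (pair_map (obj_merge N (UNIV \<times> {i. Option.these (goal_poses \<P> i) \<noteq> {}}))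
    (pair_map (obj_merge N UNIV)
    (pair_map (obj_merge N (UNIV \<times> {i. goal_held D \<P> i}))
    (pair_map (shift_merge UNIV {..N} (\<lambda>k. k - N))
    (pair_map (shift_merge UNIV {..N} (\<lambda>k. k - N))
      (shift_merge UNIV (old_seeds N) (\<lambda>(k, i, s, s'). (k - N, i, unshift_source N s, unshift_source N s'))))))))"

lemma embeds_concat_runs_left: "embeds 0 N w (concat_runs N (w, w'))"
proof -
  obtain x xg y yg c cg u where w: "w = (x, xg, y, yg, c, cg, u)" by (metis prod.exhaust)
  obtain x' xg' y' yg' c' cg' u' where w': "w' = (x', xg', y', yg', c', cg', u')" by (metis prod.exhaust)
  have sh: "shift_source 0 s = s" for s by (cases s) auto
  have "pose_source \<P> (concat_runs N (w, w')) i s = pose_source \<P> w i s" if "s \<in> sources N" for i s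
    using that by (cases s) (auto simp: w w' concat_runs_def shift_merge_def)
  moreover have "grasp_source D \<P> (concat_runs N (w, w')) i s = grasp_source D \<P> w i s"
    if "s \<in> sources N" for i s
    using that by (cases s) (auto simp: w w' concat_runs_def shift_merge_def)
  ultimately show ?thesis
    by (auto simp: embeds_def sh) (auto simp: w w' concat_runs_def shift_merge_def old_seeds_def)
qed

text \<open>A source of the second run, shifted by \<open>N\<close>, is never old: a drawn one has
  index above \<open>N\<close>, and \<open>Initial\<close> counts as new. Hence the seeds at shifted
  addresses come from the second run.\<close>

lemma embeds_concat_runs_right: "embeds N n w' (concat_runs N (w, w'))"
proof -
  obtain x xg y yg c cg u where w: "w = (x, xg, y, yg, c, cg, u)" by (metis prod.exhaust)
  obtain x' xg' y' yg' c' cg' u' where w': "w' = (x', xg', y', yg', c', cg', u')" by (metis prod.exhaust)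
  have un: "unshift_source N (shift_source N s) = s" for s by (cases s) auto
  have old: "\<not> old_source N (shift_source N s)" if "s \<in> sources n" for s using that by (cases s) auto
  have "pose_source \<P> (concat_runs N (w, w')) i (shift_source N s) = pose_source \<P> w' i s"
    if "s \<in> sources n" for i s
    using that by (cases s) (auto simp: w w' concat_runs_def shift_merge_def)
  moreover have "grasp_source D \<P> (concat_runs N (w, w')) i (shift_source N s) = grasp_source D \<P> w' i s"
    if "s \<in> sources n" for i s
    using that by (cases s) (auto simp: w w' concat_runs_def shift_merge_def)
  ultimately show ?thesis
    by (auto simp: embeds_def)
      (auto simp: w w' concat_runs_def shift_merge_def old_seeds_def un old)
qed

lemma solved_concat_runs:
  assumes "solved D \<P> S w N \<or> solved D \<P> S w' n"
  shows "solved D \<P> S (concat_runs N (w, w')) (N + n)"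
  using assms
proof
  assume "solved D \<P> S w N"
  from solved_embeds[OF embeds_concat_runs_left _ this] show ?thesis by simp
next
  assume "solved D \<P> S w' n"
  from solved_embeds[OF embeds_concat_runs_right _ this] show ?thesis by simp
qed

lemma prob_space_draws:
  assumes "valid_sampling D \<P> S"
  shows "prob_space (uniform_on (mu_pose S i) (placements D i))"
    and "Option.these (goal_poses \<P> i) \<noteq> {} \<Longrightarrow>
      prob_space (uniform_on (mu_pose S i) (Option.these (goal_poses \<P> i)))"
    and "prob_space (uniform_on (mu_grasp S) (grasps D i))"
    and "goal_held D \<P> i \<Longrightarrow> prob_space (uniform_on (mu_grasp S) (Option.these (goal_grasps \<P>)))"
    and "prob_space (uniform_on (mu_conf S) (confs D))"
    and "prob_space (uniform_on (mu_conf S) (goal_confs \<P>))"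
    and "prob_space (seed S)"
  using assms unfolding valid_sampling_def by (auto intro!: prob_space_uniform_on)

lemma prob_space_draw_space:
  assumes "valid_sampling D \<P> S"
  shows "prob_space (draw_space D \<P> S)"
  unfolding draw_space_def
  by (intro prob_space_pair_measure prob_space_PiM; use prob_space_draws[OF assms] in force)

lemma combines_concat_runs:
  assumes "valid_sampling D \<P> S"
  shows "combines (draw_space D \<P> S) (concat_runs N)"
proof -
  note [intro!] = prob_space_draws[OF assms]
  have sh: "shift_source N (unshift_source N s) = s" if "\<not> old_source N s" for s
    using that by (cases s) auto
  \<comment> \<open>Outside \<open>old_seeds\<close> all drawn indices exceed \<open>N\<close>, so
    no subtraction truncates and shifting forward again inverts the relabelling.\<close>
  have inj: "inj_on (\<lambda>(k, i, s, s'). (k - N, i, unshift_source N s, unshift_source N s'))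
      (UNIV - old_seeds N)"
  proof (rule inj_on_inverseI)
    fix x assume "x \<in> UNIV - old_seeds N"
    then show "(\<lambda>(k, i, s, s'). (k + N, i, shift_source N s, shift_source N s'))
        ((\<lambda>(k, i, s, s'). (k - N, i, unshift_source N s, unshift_source N s')) x) = x"
      by (auto simp: old_seeds_def sh)
  qed
  show ?thesis
    unfolding draw_space_def concat_runs_def
    by (intro combines_pair combines_shift_merge prob_space_pair_measure prob_space_PiM inj)
      (auto simp: inj_on_def)
qed

text \<open>If the concatenation is unsolved after \<open>N + n\<close> iterations, then so are its
  two parts after \<open>N\<close> and \<open>n\<close>. These parts are independent, and the
  concatenation has the law of a single run.\<close>

lemma unsolved_submultiplicative:
  assumes valid: "valid_sampling D \<P> S"
    and meas: "\<And>n. n \<ge> 1 \<Longrightarrow> {w \<in> space (draw_space D \<P> S). solved D \<P> S w n} \<in> sets (draw_space D \<P> S)"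
    and N: "N \<ge> 1" and n: "n \<ge> 1"
  shows "emeasure (draw_space D \<P> S) {w \<in> space (draw_space D \<P> S). \<not> solved D \<P> S w (N + n)} \<le>
    emeasure (draw_space D \<P> S) {w \<in> space (draw_space D \<P> S). \<not> solved D \<P> S w N} *
    emeasure (draw_space D \<P> S) {w \<in> space (draw_space D \<P> S). \<not> solved D \<P> S w n}"
proof -
  let ?M = "draw_space D \<P> S"
  let ?U = "\<lambda>n. {w \<in> space ?M. \<not> solved D \<P> S w n}"
  interpret prob_space ?M by (rule prob_space_draw_space) (rule valid)
  have U: "?U n \<in> sets ?M" if "n \<ge> 1" for n
  proof -
    have "?U n = space ?M - {w \<in> space ?M. solved D \<P> S w n}" by auto
    then show ?thesis using meas[OF that] by simp
  qed
  have f: "concat_runs N \<in> measurable (?M \<Otimes>\<^sub>M ?M) ?M"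
    and d: "distr (?M \<Otimes>\<^sub>M ?M) ?M (concat_runs N) = ?M"
    using combines_concat_runs[OF valid] by (auto simp: combines_def)
  have "emeasure ?M (?U (N + n)) = emeasure (distr (?M \<Otimes>\<^sub>M ?M) ?M (concat_runs N)) (?U (N + n))"
    by (simp add: d)
  also have "\<dots> = emeasure (?M \<Otimes>\<^sub>M ?M) (concat_runs N -` ?U (N + n) \<inter> space (?M \<Otimes>\<^sub>M ?M))"
    using f U[of "N + n"] N by (intro emeasure_distr) auto
  also have "\<dots> \<le> emeasure (?M \<Otimes>\<^sub>M ?M) (?U N \<times> ?U n)"
    using U N n solved_concat_runs
    by (intro emeasure_mono) (auto simp: space_pair_measure)
  also have "\<dots> = emeasure ?M (?U N) * emeasure ?M (?U n)"
    using U N n by (intro emeasure_pair_measure_Times) auto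
  finally show ?thesis .
qed

section \<open>Positive probability of success\<close>

lemma mode_confs_subset: "mode_confs D \<omega> \<subseteq> confs D"
  by (auto simp: mode_confs_def)

text \<open>Reduces the search to geometry: \<open>q i\<close> is where mode \<open>i\<close> is
  left, or the goal for \<open>i = k\<close>. Each mode contributes one move followed, except for
  the last mode, by one pick or place.\<close>

lemma solved_by_switches:
  assumes k: "k \<ge> 1" and \<omega>1: "\<omega> 1 = init_mode \<P>"
    and legal: "legal_mode D (\<omega> k)" and goal: "goal_mode \<P> (\<omega> k)"
    and q0: "q 0 = init_conf \<P>" and qk: "q k \<in> goal_confs \<P>" "q k \<in> mode_confs D (\<omega> k)"
    and move: "\<And>i. i \<in> {1..k} \<Longrightarrow> (q (i - 1), q i) \<in>
      {(x, y) \<in> vertices D \<P> S w n \<times> vertices D \<P> S w n. closed_segment x y \<subseteq> mode_confs D (\<omega> i)}\<^sup>*"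
    and vertex: "\<And>i. i \<le> k \<Longrightarrow> q i \<in> vertices D \<P> S w n"
    and switch: "\<And>i. i \<in> {1..<k} \<Longrightarrow> \<exists>j p g. switch (\<omega> i) (\<omega> (Suc i)) j p g \<and>
      p \<in> pose_samples \<P> w j n \<and> g \<in> grasp_samples D \<P> w j n \<and>
      q i \<in> ik_samples D \<P> S w j n \<inter> ik_confs D (ik_target p g)"
  shows "solved D \<P> S w n"
proof -
  let ?A = "{(s, s'). \<exists>a\<in>actions D \<P> S w n. step D \<P> S w n a s s'}"
  have moved: "((q (i - 1), \<omega> i), (q i, \<omega> i)) \<in> ?A\<^sup>*" if i: "i \<in> {1..k}" for i
  \<comment> \<open>Only pairs of distinct configurations give a \<open>Move\<close> action; for
    equal ones the state is already reached.\<close>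
  proof (cases "q (i - 1) = q i")
    case False
    have "i - 1 \<le> k" "i \<le> k" using i by auto
    then have "Move (q (i - 1)) (q i) \<in> actions D \<P> S w n"
      using False vertex[of "i - 1"] vertex[of i] by (simp add: actions_def)
    moreover have "(q (i - 1), q i) \<in>
        {(x, y) \<in> edges D \<P> S w n. closed_segment x y \<subseteq> mode_confs D (\<omega> i)}\<^sup>*"
      by (rule subsetD[OF rtrancl_mono move[OF i]])
        (use mode_confs_subset[of "\<omega> i"] in \<open>auto simp: edges_def\<close>)
    then have "step D \<P> S w n (Move (q (i - 1)) (q i)) (q (i - 1), \<omega> i) (q i, \<omega> i)"
      by (rule step.intros)
    ultimately show ?thesis by (intro r_into_rtrancl) blast
  qed simp
  have switched: "((q i, \<omega> i), (q i, \<omega> (Suc i))) \<in> ?A" if i: "i \<in> {1..<k}" for i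
  proof -
    obtain j p g where sw: "switch (\<omega> i) (\<omega> (Suc i)) j p g" and
      pg: "p \<in> pose_samples \<P> w j n" "g \<in> grasp_samples D \<P> w j n"
        "q i \<in> ik_samples D \<P> S w j n \<inter> ik_confs D (ik_target p g)"
      using switch[OF i] by blast
    have acts: "Pick j p g (q i) \<in> actions D \<P> S w n" "Place j p g (q i) \<in> actions D \<P> S w n"
      using pg unfolding actions_def by blast+
    obtain h ps where \<omega>: "\<omega> i = (h, ps)" by (cases "\<omega> i")
    from sw consider "fst g = j" "h = None" "ps j = Some p" "\<omega> (Suc i) = (Some g, ps(j := None))"
      | "fst g = j" "h = Some g" "\<omega> (Suc i) = (None, ps(j := Some p))"
      by (auto simp: switch_def \<omega>)
    then show ?thesis
    proof cases
      case 1
      then have "step D \<P> S w n (Pick j p g (q i)) (q i, \<omega> i) (q i, \<omega> (Suc i))"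
        unfolding \<omega> by (auto intro: step.intros)
      with acts show ?thesis by blast
    next
      case 2
      then have "step D \<P> S w n (Place j p g (q i)) (q i, \<omega> i) (q i, \<omega> (Suc i))"
        unfolding \<omega> by (auto intro: step.intros)
      with acts show ?thesis by blast
    qed
  qed
  have "((q 0, \<omega> 1), (q i, \<omega> i)) \<in> ?A\<^sup>*" if "1 \<le> i" "i \<le> k" for i
    using that
  proof (induction i rule: dec_induct)
    case base
    then show ?case using moved[of 1] k by simp
  next
    case (step i)
    then have "((q 0, \<omega> 1), (q i, \<omega> i)) \<in> ?A\<^sup>*" by simp
    also have "((q i, \<omega> i), (q i, \<omega> (Suc i))) \<in> ?A" using switched[of i] step by simp
    also have "((q i, \<omega> (Suc i)), (q (Suc i), \<omega> (Suc i))) \<in> ?A\<^sup>*"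
      using moved[of "Suc i"] step by simp
    finally show ?case .
  qed
  from this[of k] have "((init_conf \<P>, init_mode \<P>), (q k, \<omega> k)) \<in> ?A\<^sup>*"
    using k by (simp add: q0 \<omega>1[simplified])
  moreover have "(q k, \<omega> k) \<in> goal_states D \<P>"
    using legal goal qk by (simp add: goal_states_def legal_state_def)
  ultimately show ?thesis unfolding solved_def by blast
qed

section \<open>Mode sequences given by their parameters\<close>

lemma param_modes_held:
  assumes "ppm_domain D" and h1: "h 1 = held \<omega>\<^sub>1"
    and g: "\<And>i j. i \<in> {2..k} \<Longrightarrow> h i = Some j \<Longrightarrow> g i \<in> grasps D j"
    and i: "i \<in> {1..k}"
  shows "held (param_modes \<omega>\<^sub>1 h g p i) = h i"
proof (cases "i = 1")
  case True
  then show ?thesis using h1 by (simp add: One_nat_def[symmetric] del: One_nat_def) simp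
next
  case False
  then obtain m where m: "i = Suc m" "m \<noteq> 0" using i by (cases i) auto
  show ?thesis
  proof (cases "h i")
    case None
    then show ?thesis using m by (simp add: Let_def held_def)
  next
    case (Some j)
    moreover have "g i \<in> grasps D j" using g[OF _ Some] m i by simp
    then have "fst (g i) = j" using assms(1) by (simp add: ppm_domain_def)
    ultimately show ?thesis using m by (simp add: Let_def held_def)
  qed
qed

text \<open>Adjacency makes empty and full hand alternate, so the value of \<open>h\<close> at the
  next index decides between pick and place. Legality supplies the pose of the object to be picked;
  agreement of \<open>h\<close> with the held objects shows that the object placed is the one in
  hand.\<close>

lemma param_modes_switch:
  assumes dom: "ppm_domain D" and h1: "h 1 = held \<omega>\<^sub>1"
    and g: "\<And>i j. i \<in> {2..k} \<Longrightarrow> h i = Some j \<Longrightarrow> g i \<in> grasps D j"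
    and seq: "mode_sequence D k (param_modes \<omega>\<^sub>1 h g p)" and i: "i \<in> {1..<k}"
  obtains j p' g' where
    "switch (param_modes \<omega>\<^sub>1 h g p i) (param_modes \<omega>\<^sub>1 h g p (Suc i)) j p' g'"
    "switch_transform (param_modes \<omega>\<^sub>1 h g p i) (param_modes \<omega>\<^sub>1 h g p (Suc i)) = ik_target p' g'"
proof -
  let ?\<omega> = "param_modes \<omega>\<^sub>1 h g p"
  have i0: "i \<noteq> 0" using i by simp
  have legal: "legal_mode D (?\<omega> i)" and adj: "adjacent D (?\<omega> i) (?\<omega> (Suc i))"
    using seq i by (auto simp: mode_sequence_def)
  have held: "held (?\<omega> i) = h i"
    by (rule param_modes_held[where h = h and g = g and k = k, OF dom h1 g]) (use i in simp_all)
  have held': "held (?\<omega> (Suc i)) = h (Suc i)"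
    by (rule param_modes_held[where h = h and g = g and k = k, OF dom h1 g]) (use i in simp_all)
  have alt: "fst (?\<omega> i) = None \<longleftrightarrow> fst (?\<omega> (Suc i)) \<noteq> None"
    using adj by (simp only: adjacent_def)
  obtain hd ps where \<omega>: "?\<omega> i = (hd, ps)" by (cases "?\<omega> i")
  show thesis
  proof (cases "h (Suc i)")
    case (Some j)
    have \<omega>': "?\<omega> (Suc i) = (Some (g (Suc i)), ps(j := None))"
      using i0 by (simp add: Some Let_def \<omega>)
    have j: "fst (g (Suc i)) = j" using held' by (simp add: \<omega>' Some held_def del: param_modes.simps)
    have "hd = None" using alt by (simp add: \<omega> \<omega>' del: param_modes.simps)
    moreover have "ps j \<noteq> None"
      using legal \<open>hd = None\<close> by (simp add: legal_mode_def is_mode_def \<omega> held_def)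
    then obtain p' where "ps j = Some p'" by blast
    ultimately show thesis
      using j by (intro that[of j p' "g (Suc i)"])
        (auto simp: switch_def \<omega> \<omega>' simp del: param_modes.simps)
  next
    case None
    have \<omega>': "?\<omega> (Suc i) = (None, ps(the (h i) := Some (p (Suc i))))"
      using i0 by (simp add: None Let_def \<omega>)
    obtain g' where hd: "hd = Some g'"
      using alt by (auto simp: \<omega> \<omega>' simp del: param_modes.simps)
    have "h i = Some (fst g')" using held by (simp add: \<omega> hd held_def)
    then show thesis
      using hd by (intro that[of "fst g'" "p (Suc i)" g'])
        (auto simp: switch_def \<omega> \<omega>' simp del: param_modes.simps)
  qed
qed

text \<open>Along the sequence every pose and grasp is an initial one or a parameter. With
  \<open>X\<close> and \<open>Y\<close> the sampled values, steering the parameters makes everything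
  available that the plan needs.\<close>

lemma param_modes_samples:
  assumes dom: "ppm_domain D" and h1: "h 1 = held \<omega>\<^sub>1"
    and gr: "\<And>i j. i \<in> {2..k} \<Longrightarrow> h i = Some j \<Longrightarrow> g i \<in> grasps D j"
    and init: "\<And>j p'. snd \<omega>\<^sub>1 j = Some p' \<Longrightarrow> p' \<in> X j" "\<And>g'. fst \<omega>\<^sub>1 = Some g' \<Longrightarrow> g' \<in> Y (fst g')"
    and p: "\<And>i. i \<in> {2..k} \<Longrightarrow> h i = None \<Longrightarrow> p i \<in> X (the (h (i - 1)))"
    and g: "\<And>i j. i \<in> {2..k} \<Longrightarrow> h i = Some j \<Longrightarrow> g i \<in> Y j"
    and i: "i \<in> {1..k}"
  shows "(\<forall>j p'. snd (param_modes \<omega>\<^sub>1 h g p i) j = Some p' \<longrightarrow> p' \<in> X j) \<and>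
    (\<forall>g'. fst (param_modes \<omega>\<^sub>1 h g p i) = Some g' \<longrightarrow> g' \<in> Y (fst g'))"
  using i
proof (induction i)
  case 0
  then show ?case by simp
next
  case (Suc i)
  show ?case
  proof (cases "i = 0")
    case True
    then show ?thesis using init by simp
  next
    case False
    with Suc have IH: "\<forall>j p'. snd (param_modes \<omega>\<^sub>1 h g p i) j = Some p' \<longrightarrow> p' \<in> X j" by simp
    have i2: "Suc i \<in> {2..k}" using False Suc.prems by simp
    show ?thesis
    proof (cases "h (Suc i)")
      case None
      then show ?thesis using False IH p[OF i2 None] by (simp add: Let_def)
    next
      case (Some j)
      then have "fst (g (Suc i)) = j" using gr[OF i2 Some] dom by (simp add: ppm_domain_def)
      then show ?thesis using Some False IH g[OF i2 Some] by (simp add: Let_def del: split_paired_All)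
    qed
  qed
qed

text \<open>Pose addresses are thus known once the poses are fixed, before seeds and configurations
  are chosen. The next lemma serves grasp addresses.\<close>

lemma pose_source_params:
  "pose_source \<P> (x, xg, y, yg, c, cg, u) i = pose_source \<P> (x, xg, y', yg', c', cg', u') i"
proof
  show "pose_source \<P> (x, xg, y, yg, c, cg, u) i s = pose_source \<P> (x, xg, y', yg', c', cg', u') i s" for s
    by (cases s) auto
qed

lemma grasp_source_params:
  "grasp_source D \<P> (x, xg, y, yg, c, cg, u) i = grasp_source D \<P> (x', xg', y, yg, c', cg', u') i"
proof
  show "grasp_source D \<P> (x, xg, y, yg, c, cg, u) i s = grasp_source D \<P> (x', xg', y, yg, c', cg', u') i s" for s
    by (cases s) auto
qed

text \<open>The probability that a run with these parameters succeeds has no uniform lower bound: it depends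
  on the constants of the robust problems. It suffices that it is positive.\<close>

lemma not_AE_unsolved_if_params:
  fixes x xg :: "nat \<times> 'o \<Rightarrow> 'w transform" and y yg :: "nat \<times> 'o \<Rightarrow> ('o, 'w) grasp"
    and W :: "(nat \<Rightarrow> 'c) \<Rightarrow> (nat \<Rightarrow> 'c) \<Rightarrow> (nat \<times> 'o \<times> source \<times> source \<Rightarrow> 'u) \<Rightarrow> ('c, 'o, 'w, 'u) draws"
  defines "W \<equiv> \<lambda>c cg u. (x, xg, y, yg, c, cg, u)"
  assumes valid: "valid_sampling D \<P> S"
    and k: "k \<ge> 1" and \<omega>1: "\<omega> 1 = init_mode \<P>"
    and seq: "mode_sequence D k \<omega>" and goal: "goal_mode \<P> (\<omega> k)"
    and robust: "robust_multi_mode D (mu_conf S) (init_conf \<P>) (goal_confs \<P>) k \<omega>"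
    and switches: "\<And>i. i \<in> {1..<k} \<Longrightarrow> \<exists>j p g. switch (\<omega> i) (\<omega> (Suc i)) j p g \<and>
      switch_transform (\<omega> i) (\<omega> (Suc i)) = ik_target p g \<and>
      (\<forall>c cg u. p \<in> pose_samples \<P> (W c cg u) j k \<and> g \<in> grasp_samples D \<P> (W c cg u) j k)"
    and unsolved: "AE r in (\<Pi>\<^sub>M n\<in>UNIV. uniform_on (mu_conf S) (confs D)) \<Otimes>\<^sub>M
      (\<Pi>\<^sub>M n\<in>UNIV. uniform_on (mu_conf S) (goal_confs \<P>)) \<Otimes>\<^sub>M (\<Pi>\<^sub>M x\<in>UNIV. seed S).
      \<forall>n\<ge>1. \<not> solved D \<P> S (x, xg, y, yg, r) n"
  shows False
proof -
  let ?X = "\<lambda>i. ik_confs D (switch_transform (\<omega> i) (\<omega> (Suc i)))"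
  from robust[unfolded robust_multi_mode_def Let_def] obtain Qs \<epsilon> where \<epsilon>: "\<epsilon> > 0" and Qs0: "Qs 0 = {init_conf \<P>}"
    and Qs: "\<forall>i\<in>{1..<k}. Qs i \<subseteq> ?X i \<and> Qs i \<in> sets (mu_conf S (?X i)) \<and>
      \<epsilon> \<le> rel_measure (mu_conf S) (Qs i) (?X i)"
    and Qsk: "Qs k \<subseteq> goal_confs \<P>" "\<epsilon> \<le> rel_measure (mu_conf S) (Qs k) (goal_confs \<P>)"
    and motion: "\<forall>i\<in>{1..k}. \<forall>q\<in>Qs (i - 1). \<forall>q'\<in>Qs i. robust_motion (mode_confs D (\<omega> i)) q q'"
    by (elim exE conjE) (rule that; assumption)
  obtain \<kappa> where \<kappa>: "\<kappa> > 0" and ik: "\<And>t E. ik_confs D t \<noteq> {} \<Longrightarrow>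
      E \<in> sets (mu_conf S (ik_confs D t)) \<Longrightarrow>
      \<kappa> * rel_measure (mu_conf S) E (ik_confs D t) \<le> measure (seed S) {u \<in> space (seed S). ik S t u \<in> E}"
    using valid unfolding valid_sampling_def by blast
  have ik_meas: "ik S t \<in> measurable (seed S) (mu_conf S (ik_confs D t))" if "ik_confs D t \<noteq> {}" for t
    using valid that unfolding valid_sampling_def by blast
  obtain J p g where J: "\<And>i. i \<in> {1..<k} \<Longrightarrow> switch (\<omega> i) (\<omega> (Suc i)) (J i) (p i) (g i)"
    and T: "\<And>i. i \<in> {1..<k} \<Longrightarrow> switch_transform (\<omega> i) (\<omega> (Suc i)) = ik_target (p i) (g i)"
    and pg: "\<And>i c cg u. i \<in> {1..<k} \<Longrightarrow> p i \<in> pose_samples \<P> (W c cg u) (J i) k \<and>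
      g i \<in> grasp_samples D \<P> (W c cg u) (J i) k"
    using switches by metis
  define t where "t i = ik_target (p i) (g i)" for i
  have nonempty: "ik_confs D (t i) \<noteq> {}" if "i \<in> {1..<k}" for i
  proof -
    have "adjacent D (\<omega> i) (\<omega> (Suc i))" using seq that unfolding mode_sequence_def by blast
    then have "?X i \<noteq> {}" unfolding adjacent_def by blast
    then show ?thesis by (simp add: T[OF that] t_def)
  qed
  \<comment> \<open>Transition \<open>i\<close> uses the seed of iteration \<open>k + i\<close>: all
    parameters are present from iteration \<open>k\<close> on, and distinct iterations give distinct
    coordinates, so the seeds can be steered separately. \<open>fst a - k\<close> recovers
    \<open>i\<close>. The addresses do not depend on the components filled with
    \<open>undefined\<close>.\<close>
  define addr where "addr i = (k + i, J i,
      address (pose_source \<P> (W undefined undefined undefined) (J i)) (k + i) (p i),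
      address (grasp_source D \<P> (W undefined undefined undefined) (J i)) (k + i) (g i))" for i
  \<comment> \<open>The seeds that send inverse kinematics into \<open>Qs i\<close>; their
    probability is at least \<kappa> * \<epsilon>.\<close>
  define A where "A i = {u \<in> space (seed S). ik S (t i) u \<in> Qs i}" for i
  have A: "A i \<in> sets (seed S)" "0 < emeasure (seed S) (A i)" if i: "i \<in> {1..<k}" for i
  proof -
    have Qi: "Qs i \<in> sets (mu_conf S (ik_confs D (t i)))"
      "\<epsilon> \<le> rel_measure (mu_conf S) (Qs i) (ik_confs D (t i))"
      using bspec[OF Qs i] by (simp_all add: T[OF i] t_def)
    show "A i \<in> sets (seed S)"
      using measurable_sets[OF ik_meas[OF nonempty[OF i]] Qi(1)]
      by (simp add: A_def vimage_def Int_def conj_commute)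
    have "0 < \<kappa> * rel_measure (mu_conf S) (Qs i) (ik_confs D (t i))"
      using \<kappa> \<epsilon> Qi(2) by simp
    also have "\<dots> \<le> measure (seed S) (A i)"
      unfolding A_def by (rule ik[OF nonempty[OF i] Qi(1)])
    finally show "0 < emeasure (seed S) (A i)"
      by (auto simp: measure_def enn2real_positive_iff)
  qed
  note prob = prob_space_draws[OF valid]
  let ?Mc = "\<Pi>\<^sub>M (n::nat)\<in>UNIV. uniform_on (mu_conf S) (confs D)"
  let ?Mcg = "\<Pi>\<^sub>M (n::nat)\<in>UNIV. uniform_on (mu_conf S) (goal_confs \<P>)"
  let ?Mu = "\<Pi>\<^sub>M (x::nat \<times> 'o \<times> source \<times> source)\<in>UNIV. seed S"
  have probs: "prob_space ?Mc" "prob_space ?Mcg" "prob_space ?Mu"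
    using prob by (auto intro: prob_space_PiM)
  \<comment> \<open>The free configurations are moved to the innermost position: the balls they must
    hit depend on the goal configuration and the seeds.\<close>
  have "AE r in ?Mcg \<Otimes>\<^sub>M ?Mu. AE c in ?Mc. \<forall>n\<ge>1. \<not> solved D \<P> S (x, xg, y, yg, c, r) n"
    using AE_pair_measure_swap[OF probs(1) prob_space_pair_measure[OF probs(2,3)] unsolved] by simp
  from AE_pair_measure_sections[OF probs(2,3) this]
  have 1: "AE cg in ?Mcg. AE u in ?Mu. AE c in ?Mc. \<forall>n\<ge>1. \<not> solved D \<P> S (W c cg u) n"
    by (simp add: W_def)
  have goal_pos: "Qs k \<in> sets (uniform_on (mu_conf S) (goal_confs \<P>))"
    "0 < emeasure (uniform_on (mu_conf S) (goal_confs \<P>)) (Qs k)"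
    using valid \<epsilon> Qsk(2) by (auto intro!: uniform_on_pos simp: valid_sampling_def)
  obtain cg where cg: "cg (1::nat) \<in> Qs k"
    and 2: "AE u in ?Mu. AE c in ?Mc. \<forall>n\<ge>1. \<not> solved D \<P> S (W c cg u) n"
    by (rule AE_PiM_obtain[where I = "UNIV :: nat set" and J = "{1}" and A = "\<lambda>_. Qs k", OF _ _ _ _ _ 1])
      (use prob goal_pos in auto)
  obtain u where u: "\<And>a. a \<in> addr ` {1..<k} \<Longrightarrow> u a \<in> A (fst a - k)"
    and 3: "AE c in ?Mc. \<forall>n\<ge>1. \<not> solved D \<P> S (W c cg u) n"
    by (rule AE_PiM_obtain[where I = UNIV and J = "addr ` {1..<k}" and A = "\<lambda>a. A (fst a - k)", OF _ _ _ _ _ 2])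
      (use prob A in \<open>auto simp: addr_def\<close>)
  define q where "q i = (if i = 0 then init_conf \<P> else if i = k then cg 1 else ik S (t i) (u (addr i)))" for i
  have q: "q i \<in> Qs i" if i: "i \<le> k" for i
  proof -
    consider "i = 0" | "i = k" "i \<noteq> 0" | "i \<in> {1..<k}"
      using i by (cases "i = 0"; cases "i = k") auto
    then show ?thesis
    proof cases
      case 1 then show ?thesis using Qs0 by (simp add: q_def)
    next
      case 2 then show ?thesis using cg by (simp add: q_def)
    next
      case 3
      then have "u (addr i) \<in> A i" using u[of "addr i"] by (simp add: addr_def)
      then show ?thesis using 3 by (simp add: q_def A_def)
    qed
  qed
  have rm: "robust_motion (mode_confs D (\<omega> i)) (q (i - 1)) (q i)" if "i \<in> {1..k}" for i
    using that q[of "i - 1"] q[of i] motion by auto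
  let ?R = "\<lambda>i V. {(x, y) \<in> V \<times> V. closed_segment x y \<subseteq> mode_confs D (\<omega> i)}"
  let ?net = "\<lambda>i \<B>. finite \<B> \<and> (\<forall>B\<in>\<B>. open B \<and> B \<noteq> {} \<and> B \<subseteq> mode_confs D (\<omega> i)) \<and>
      (\<forall>V. q (i - 1) \<in> V \<longrightarrow> q i \<in> V \<longrightarrow> (\<forall>B\<in>\<B>. V \<inter> B \<noteq> {}) \<longrightarrow> (q (i - 1), q i) \<in> (?R i V)\<^sup>*)"
  have "\<forall>i\<in>{1..k}. \<exists>\<B>. ?net i \<B>"
  proof
    fix i assume "i \<in> {1..k}"
    from rm[OF this] show "\<exists>\<B>. ?net i \<B>"
      by (rule robust_motion_net) (intro exI conjI ballI allI impI; assumption?; simp)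
  qed
  from bchoice[OF this] obtain \<B> where nets: "\<forall>i\<in>{1..k}. ?net i (\<B> i)" ..
  note nets = bspec[OF nets]
  note \<B> = conjunct1[OF nets] conjunct1[OF conjunct2[OF nets]]
  have net: "(q (i - 1), q i) \<in> (?R i V)\<^sup>*"
    if i: "i \<in> {1..k}" and V: "q (i - 1) \<in> V" "q i \<in> V" "\<forall>B\<in>\<B> i. V \<inter> B \<noteq> {}" for i V
    by (rule nets[OF i, THEN conjunct2, THEN conjunct2, THEN spec, THEN mp, THEN mp, THEN mp, OF V])
  \<comment> \<open>One list of balls serves all \<open>k\<close> motions. They lie in
    \<open>confs D\<close> and are open and nonempty, so a free draw hits each with positive
    probability.\<close>
  have "finite (\<Union>i\<in>{1..k}. \<B> i)" using \<B>(1) by blast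
  then obtain N :: nat and b where b: "(\<Union>i\<in>{1..k}. \<B> i) = b ` {i. i < N}"
    unfolding finite_conv_nat_seg_image by blast
  have b_pos: "b m \<in> sets (uniform_on (mu_conf S) (confs D))"
    "0 < emeasure (uniform_on (mu_conf S) (confs D)) (b m)" if "m < N" for m
  proof -
    have "b m \<in> (\<Union>i\<in>{1..k}. \<B> i)" unfolding b using that by blast
    then have bm: "open (b m)" "b m \<noteq> {}" "b m \<subseteq> confs D"
      using \<B>(2) mode_confs_subset by (blast, blast, blast)
    have conf: "confs D \<in> sets lebesgue" "mu_conf S (confs D) = lebesgue_on (confs D)"
      "sampled_space (mu_conf S) (confs D)"
      using valid by (auto simp: valid_sampling_def)
    have sets: "b m \<in> sets (mu_conf S (confs D))" and pos: "0 < emeasure (mu_conf S (confs D)) (b m)"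
      unfolding conf(2) using emeasure_lebesgue_on_open_pos[OF bm conf(1)] by auto
    show "b m \<in> sets (uniform_on (mu_conf S) (confs D))"
      using sets by (simp add: uniform_on_def)
    have fin: "emeasure (mu_conf S (confs D)) (b m) < \<infinity>"
      using emeasure_space[of "mu_conf S (confs D)" "b m"] conf(3)
      by (auto simp: sampled_space_def intro: le_less_trans)
    have "0 < measure (mu_conf S (confs D)) (b m)" "0 < measure (mu_conf S (confs D)) (confs D)"
      using pos fin conf(3) by (auto simp: measure_def enn2real_positive_iff sampled_space_def)
    then have "0 < rel_measure (mu_conf S) (b m) (confs D)" by (simp add: rel_measure_def)
    then show "0 < emeasure (uniform_on (mu_conf S) (confs D)) (b m)"
      by (rule uniform_on_pos(2)[OF conf(3)])
  qed
  \<comment> \<open>Iteration \<open>m\<close> is used for ball \<open>m - 1\<close>: iterations are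
    counted from 1, balls from 0.\<close>
  obtain c where c: "\<And>m. m \<in> {1..N} \<Longrightarrow> c m \<in> b (m - 1)"
    and 4: "\<forall>n\<ge>1. \<not> solved D \<P> S (W c cg u) n"
    by (rule AE_PiM_obtain[where I = UNIV and J = "{1..N}" and A = "\<lambda>m. b (m - 1)", OF _ _ _ _ _ 3])
      (use prob b_pos in auto)
  \<comment> \<open>Late enough for the seeds of iterations \<open>k + i\<close> with
    \<open>i < k\<close>, the goal draw of iteration 1 and the \<open>N\<close> free draws.\<close>
  define n where "n = k + k + N"
  define w where "w = W c cg u"
  have ps: "p i \<in> pose_samples \<P> w (J i) l" and gs: "g i \<in> grasp_samples D \<P> w (J i) l"
    if "i \<in> {1..<k}" "k \<le> l" for i l
    using pg[OF that(1), of c cg u] that(2)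
    unfolding w_def pose_samples_def grasp_samples_def samples_def by fastforce+
  have ik_q: "q i \<in> ik_samples D \<P> S w (J i) n" if i: "i \<in> {1..<k}" for i
  proof -
    have "(p i, g i) \<in> ik_pairs D \<P> w (J i) (k + i)"
      using ps[OF i] gs[OF i] nonempty[OF i] by (simp add: ik_pairs_def t_def)
    moreover have "q i = ik S (ik_target (p i) (g i)) (seed_draw w (k + i, J i,
        address (pose_source \<P> w (J i)) (k + i) (p i), address (grasp_source D \<P> w (J i)) (k + i) (g i)))"
    proof -
      have "pose_source \<P> w (J i) = pose_source \<P> (W undefined undefined undefined) (J i)"
        unfolding w_def W_def by (rule pose_source_params)
      moreover have "grasp_source D \<P> w (J i) = grasp_source D \<P> (W undefined undefined undefined) (J i)"
        unfolding w_def W_def by (rule grasp_source_params)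
      moreover have "seed_draw w a = u a" for a by (simp add: w_def W_def)
      ultimately show ?thesis using i by (simp add: q_def t_def addr_def)
    qed
    moreover have "k + i \<in> {1..n}" using i by (auto simp: n_def)
    ultimately show ?thesis unfolding ik_samples_def by force
  qed
  have vertex: "q i \<in> vertices D \<P> S w n" if i: "i \<le> k" for i
  proof -
    consider "i = 0" | "i = k" "i \<noteq> 0" | "i \<in> {1..<k}"
      using i by (cases "i = 0"; cases "i = k") auto
    then show ?thesis
    proof cases
      case 1 then show ?thesis by (simp add: q_def vertices_def)
    next
      case 2
      have "q i = goal_conf_draw w 1" using 2 by (simp add: q_def w_def W_def)
      moreover have "1 \<in> {1..n}" using k by (simp add: n_def)
      ultimately show ?thesis unfolding vertices_def by blast
    next
      case 3 then show ?thesis using ik_q[of i] unfolding vertices_def by blast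
    qed
  qed
  have hit: "vertices D \<P> S w n \<inter> B \<noteq> {}" if B: "i \<in> {1..k}" "B \<in> \<B> i" for i B
  proof -
    from B have "B \<in> b ` {i. i < N}" unfolding b[symmetric] by blast
    then obtain m where m: "m < N" "B = b m" by blast
    then have "c (Suc m) \<in> B" using c[of "Suc m"] by simp
    moreover have "c (Suc m) = conf_draw w (Suc m)" by (simp add: w_def W_def)
    moreover have "Suc m \<in> {1..n}" using m by (simp add: n_def)
    ultimately show ?thesis unfolding vertices_def by blast
  qed
  have "solved D \<P> S w n"
  proof (rule solved_by_switches[where \<omega> = \<omega> and k = k and q = q])
    show "legal_mode D (\<omega> k)" using seq k by (simp add: mode_sequence_def)
    show "q 0 = init_conf \<P>" by (simp add: q_def)
    show "q k \<in> goal_confs \<P>" using q[of k] Qsk(1) by blast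
    show "q k \<in> mode_confs D (\<omega> k)" using rm[of k] k by (simp add: robust_motion_def)
    show "(q (i - 1), q i) \<in> {(x, y) \<in> vertices D \<P> S w n \<times> vertices D \<P> S w n.
        closed_segment x y \<subseteq> mode_confs D (\<omega> i)}\<^sup>*" if i: "i \<in> {1..k}" for i
      by (rule net[OF i]) (use i hit[OF i] in \<open>auto intro!: vertex\<close>)
    show "\<exists>j p g. switch (\<omega> i) (\<omega> (Suc i)) j p g \<and> p \<in> pose_samples \<P> w j n \<and>
        g \<in> grasp_samples D \<P> w j n \<and> q i \<in> ik_samples D \<P> S w j n \<inter> ik_confs D (ik_target p g)"
      if i: "i \<in> {1..<k}" for i
    proof (intro exI conjI IntI)
      show "switch (\<omega> i) (\<omega> (Suc i)) (J i) (p i) (g i)" by (rule J[OF i])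
      show "p i \<in> pose_samples \<P> w (J i) n" "g i \<in> grasp_samples D \<P> w (J i) n"
        using ps[OF i] gs[OF i] by (auto simp: n_def)
      show "q i \<in> ik_samples D \<P> S w (J i) n" by (rule ik_q[OF i])
      show "q i \<in> ik_confs D (ik_target (p i) (g i))"
        using q[of i] bspec[OF Qs i] i by (auto simp: T[OF i])
    qed
  qed (use k \<omega>1 goal vertex in auto)
  then show False using 4 k by (auto simp: w_def n_def)
qed

text \<open>Parameter \<open>i\<close> is steered in iteration \<open>i\<close>, so different
  parameters use different coordinates even if they concern the same object. The components are
  fixed one after another, each by passing to a section of the almost sure statement.\<close>

lemma not_AE_unsolved:
  assumes dom: "ppm_domain D" and valid: "valid_sampling D \<P> S"
    and feasible: "robustly_feasible D \<P> S"
    and unsolved: "AE w in draw_space D \<P> S. \<forall>n\<ge>1. \<not> solved D \<P> S w n"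
  shows False
proof -
  from feasible[unfolded robustly_feasible_def Let_def] obtain k h Gs Ps where
    k: "k \<ge> 1" and h1: "h 1 = held (init_mode \<P>)" and
    params: "\<forall>i\<in>{2..k}. case h i of
             Some j \<Rightarrow> Gs i \<subseteq> grasps D j \<and> grasp_measure D \<P> S j (Gs i) > 0
           | None \<Rightarrow> Ps i \<subseteq> placements D (the (h (i - 1))) \<and>
                     pose_measure D \<P> S (the (h (i - 1))) (Ps i) > 0" and
    robust: "\<forall>g p. (\<forall>i\<in>{2..k}. case h i of Some j \<Rightarrow> g i \<in> Gs i | None \<Rightarrow> p i \<in> Ps i) \<longrightarrow>
      mode_sequence D k (param_modes (init_mode \<P>) h g p) \<and>
      goal_mode \<P> (param_modes (init_mode \<P>) h g p k) \<and>
      robust_multi_mode D (mu_conf S) (init_conf \<P>) (goal_confs \<P>) k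
        (param_modes (init_mode \<P>) h g p)"
    by (elim exE conjE) (rule that; assumption)
  define jp where "jp i = the (h (i - 1))" for i
  define jg where "jg i = the (h i)" for i
  \<comment> \<open>\<open>gp\<close> and \<open>gg\<close> record which case of the two parameter
    measures applies, hence whether the value comes from the goal draw or from the draw in the full
    space.\<close>
  define gp where "gp i \<longleftrightarrow> Ps i \<subseteq> Option.these (goal_poses \<P> (jp i))" for i
  define gg where "gg i \<longleftrightarrow> goal_held D \<P> (jg i) \<and> Gs i \<subseteq> Option.these (goal_grasps \<P>)" for i
  let ?pose = "{i \<in> {2..k}. h i = None}" and ?grasp = "{i \<in> {2..k}. h i \<noteq> None}"
  have pose_pos: "pose_measure D \<P> S (jp i) (Ps i) > 0" if "i \<in> ?pose" for i
    using bspec[OF params, of i] that by (simp add: jp_def)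
  have grasp_pos: "grasp_measure D \<P> S (jg i) (Gs i) > 0" "Gs i \<subseteq> grasps D (jg i)" if "i \<in> ?grasp" for i
    using bspec[OF params, of i] that by (auto simp: jg_def)
  have spaces: "sampled_space (mu_pose S j) (placements D j)" "sampled_space (mu_grasp S) (grasps D j)"
    "Option.these (goal_poses \<P> j) \<noteq> {} \<Longrightarrow> sampled_space (mu_pose S j) (Option.these (goal_poses \<P> j))"
    "goal_held D \<P> j \<Longrightarrow> sampled_space (mu_grasp S) (Option.these (goal_grasps \<P>))" for j
    using valid unfolding valid_sampling_def by blast+
  \<comment> \<open>With an empty goal set there is no goal draw to steer; but then
    \<open>Ps i\<close> would be empty and of measure 0.\<close>
  have goal_nonempty: "Option.these (goal_poses \<P> (jp i)) \<noteq> {}" if "i \<in> ?pose" "gp i" for i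
  proof
    assume "Option.these (goal_poses \<P> (jp i)) = {}"
    moreover from this have "Ps i = {}" using that(2) by (simp add: gp_def)
    ultimately show False using pose_pos[OF that(1)] by (simp add: pose_measure_def rel_measure_def)
  qed
  have pose_rel: "0 < rel_measure (mu_pose S (jp i)) (Ps i) (Option.these (goal_poses \<P> (jp i)))"
    if "i \<in> ?pose" "gp i" for i
    using pose_pos[OF that(1)] that(2) by (simp add: pose_measure_def gp_def)
  have pose_rel': "0 < rel_measure (mu_pose S (jp i)) (Ps i) (placements D (jp i))"
    if "i \<in> ?pose" "\<not> gp i" for i
    using pose_pos[OF that(1)] that(2) by (simp add: pose_measure_def gp_def)
  have grasp_rel: "0 < rel_measure (mu_grasp S) (Gs i) (Option.these (goal_grasps \<P>))"
    if "i \<in> ?grasp" "gg i" for i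
    using grasp_pos(1)[OF that(1)] that(2) by (simp add: grasp_measure_def gg_def)
  have grasp_rel': "0 < rel_measure (mu_grasp S) (Gs i) (grasps D (jg i))"
    if "i \<in> ?grasp" "\<not> gg i" for i
    using grasp_pos(1)[OF that(1)] that(2) unfolding grasp_measure_def gg_def by argo
  note prob = prob_space_draws[OF valid]
  let ?Mx = "\<Pi>\<^sub>M (n::nat, i)\<in>UNIV. uniform_on (mu_pose S i) (placements D i)"
  let ?Mxg = "\<Pi>\<^sub>M (n::nat, i)\<in>UNIV \<times> {i. Option.these (goal_poses \<P> i) \<noteq> {}}.
        uniform_on (mu_pose S i) (Option.these (goal_poses \<P> i))"
  let ?My = "\<Pi>\<^sub>M (n::nat, i)\<in>UNIV. uniform_on (mu_grasp S) (grasps D i)"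
  let ?Myg = "\<Pi>\<^sub>M (n::nat, i)\<in>UNIV \<times> {i. goal_held D \<P> i}.
        uniform_on (mu_grasp S) (Option.these (goal_grasps \<P>))"
  let ?Mr = "(\<Pi>\<^sub>M (n::nat)\<in>UNIV. uniform_on (mu_conf S) (confs D)) \<Otimes>\<^sub>M
      (\<Pi>\<^sub>M (n::nat)\<in>UNIV. uniform_on (mu_conf S) (goal_confs \<P>)) \<Otimes>\<^sub>M
      (\<Pi>\<^sub>M (x :: nat \<times> 'o \<times> source \<times> source)\<in>UNIV. seed S)"
  have probs: "prob_space ?Mx" "prob_space ?Mxg" "prob_space ?My" "prob_space ?Myg" "prob_space ?Mr"
    by (intro prob_space_pair_measure prob_space_PiM; use prob in force)+
  have "AE w in ?Mx \<Otimes>\<^sub>M ?Mxg \<Otimes>\<^sub>M ?My \<Otimes>\<^sub>M ?Myg \<Otimes>\<^sub>M ?Mr. \<forall>n\<ge>1. \<not> solved D \<P> S w n"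
    using unsolved unfolding draw_space_def .
  from AE_pair_measure_sections[OF probs(1) _ this]
  have 1: "AE x in ?Mx. AE r in ?Mxg \<Otimes>\<^sub>M ?My \<Otimes>\<^sub>M ?Myg \<Otimes>\<^sub>M ?Mr. \<forall>n\<ge>1. \<not> solved D \<P> S (x, r) n"
    using probs by (simp add: prob_space_pair_measure)
  obtain x where x: "\<And>a. a \<in> (\<lambda>i. (i, jp i)) ` {i \<in> ?pose. \<not> gp i} \<Longrightarrow> x a \<in> Ps (fst a)"
    and "AE r in ?Mxg \<Otimes>\<^sub>M ?My \<Otimes>\<^sub>M ?Myg \<Otimes>\<^sub>M ?Mr. \<forall>n\<ge>1. \<not> solved D \<P> S (x, r) n"
    by (rule AE_PiM_obtain[where J = "(\<lambda>i. (i, jp i)) ` {i \<in> ?pose. \<not> gp i}" and A = "\<lambda>a. Ps (fst a)",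
          OF _ _ _ _ _ 1])
      (use prob uniform_on_pos[OF spaces(1) pose_rel'] in auto)
  from AE_pair_measure_sections[OF probs(2) _ this(2)]
  have 2: "AE xg in ?Mxg. AE r in ?My \<Otimes>\<^sub>M ?Myg \<Otimes>\<^sub>M ?Mr. \<forall>n\<ge>1. \<not> solved D \<P> S (x, xg, r) n"
    using probs by (simp add: prob_space_pair_measure)
  obtain xg where xg: "\<And>a. a \<in> (\<lambda>i. (i, jp i)) ` {i \<in> ?pose. gp i} \<Longrightarrow> xg a \<in> Ps (fst a)"
    and "AE r in ?My \<Otimes>\<^sub>M ?Myg \<Otimes>\<^sub>M ?Mr. \<forall>n\<ge>1. \<not> solved D \<P> S (x, xg, r) n"
    by (rule AE_PiM_obtain[where J = "(\<lambda>i. (i, jp i)) ` {i \<in> ?pose. gp i}" and A = "\<lambda>a. Ps (fst a)",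
          OF _ _ _ _ _ 2])
      (use prob uniform_on_pos[OF spaces(3)[OF goal_nonempty] pose_rel] goal_nonempty in auto)
  from AE_pair_measure_sections[OF probs(3) _ this(2)]
  have 3: "AE y in ?My. AE r in ?Myg \<Otimes>\<^sub>M ?Mr. \<forall>n\<ge>1. \<not> solved D \<P> S (x, xg, y, r) n"
    using probs by (simp add: prob_space_pair_measure)
  obtain y where y: "\<And>a. a \<in> (\<lambda>i. (i, jg i)) ` {i \<in> ?grasp. \<not> gg i} \<Longrightarrow> y a \<in> Gs (fst a)"
    and "AE r in ?Myg \<Otimes>\<^sub>M ?Mr. \<forall>n\<ge>1. \<not> solved D \<P> S (x, xg, y, r) n"
    by (rule AE_PiM_obtain[where J = "(\<lambda>i. (i, jg i)) ` {i \<in> ?grasp. \<not> gg i}" and A = "\<lambda>a. Gs (fst a)",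
          OF _ _ _ _ _ 3])
      (use prob uniform_on_pos[OF spaces(2) grasp_rel'] in auto)
  from AE_pair_measure_sections[OF probs(4,5) this(2)]
  have 4: "AE yg in ?Myg. AE r in ?Mr. \<forall>n\<ge>1. \<not> solved D \<P> S (x, xg, y, yg, r) n" .
  have gg_held: "goal_held D \<P> (jg i)" if "gg i" for i using that by (simp add: gg_def)
  obtain yg where yg: "\<And>a. a \<in> (\<lambda>i. (i, jg i)) ` {i \<in> ?grasp. gg i} \<Longrightarrow> yg a \<in> Gs (fst a)"
    and 5: "AE r in ?Mr. \<forall>n\<ge>1. \<not> solved D \<P> S (x, xg, y, yg, r) n"
    by (rule AE_PiM_obtain[where J = "(\<lambda>i. (i, jg i)) ` {i \<in> ?grasp. gg i}" and A = "\<lambda>a. Gs (fst a)",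
          OF _ _ _ _ _ 4])
      (use prob uniform_on_pos[OF spaces(4)[OF gg_held] grasp_rel] gg_held in auto)
  define p where "p i = (if gp i then xg (i, jp i) else x (i, jp i))" for i
  define g where "g i = (if gg i then yg (i, jg i) else y (i, jg i))" for i
  let ?\<omega> = "param_modes (init_mode \<P>) h g p"
  have p: "p i \<in> Ps i" if "i \<in> ?pose" for i
    using x[of "(i, jp i)"] xg[of "(i, jp i)"] that by (auto simp: p_def)
  have g: "g i \<in> Gs i" if "i \<in> ?grasp" for i
    using y[of "(i, jg i)"] yg[of "(i, jg i)"] that unfolding g_def by auto
  have "\<forall>i\<in>{2..k}. case h i of Some j \<Rightarrow> g i \<in> Gs i | None \<Rightarrow> p i \<in> Ps i"
  proof
    fix i assume "i \<in> {2..k}"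
    then show "case h i of Some j \<Rightarrow> g i \<in> Gs i | None \<Rightarrow> p i \<in> Ps i"
      using p[of i] g[of i] by (cases "h i") (simp_all del: split_paired_All)
  qed
  with robust have seq: "mode_sequence D k ?\<omega>" and goal: "goal_mode \<P> (?\<omega> k)"
    and multi: "robust_multi_mode D (mu_conf S) (init_conf \<P>) (goal_confs \<P>) k ?\<omega>"
    by blast+
  have grasps: "g i \<in> grasps D j" if "i \<in> {2..k}" "h i = Some j" for i j
    using g[of i] grasp_pos(2)[of i] that by (auto simp: jg_def)
  have samples: "(\<forall>j p'. snd (?\<omega> i) j = Some p' \<longrightarrow> p' \<in> pose_samples \<P> (x, xg, y, yg, c, cg, u) j k) \<and>
      (\<forall>g'. fst (?\<omega> i) = Some g' \<longrightarrow> g' \<in> grasp_samples D \<P> (x, xg, y, yg, c, cg, u) (fst g') k)"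
    if "i \<in> {1..k}" for i c cg and u :: "nat \<times> 'o \<times> source \<times> source \<Rightarrow> 'u"
  proof (rule param_modes_samples[where h = h and g = g and p = p and k = k and
        X = "\<lambda>j. pose_samples \<P> (x, xg, y, yg, c, cg, u) j k" and
        Y = "\<lambda>j. grasp_samples D \<P> (x, xg, y, yg, c, cg, u) j k", OF dom h1 grasps _ _ _ _ that])
    show "p' \<in> pose_samples \<P> (x, xg, y, yg, c, cg, u) j k" if "snd (init_mode \<P>) j = Some p'" for j p'
      using that by (simp add: pose_samples_def samples_def)
    show "g' \<in> grasp_samples D \<P> (x, xg, y, yg, c, cg, u) (fst g') k" if "fst (init_mode \<P>) = Some g'" for g'
      using that by (simp add: grasp_samples_def samples_def held_def)
    show "p i \<in> pose_samples \<P> (x, xg, y, yg, c, cg, u) (the (h (i - 1))) k"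
      if "i \<in> {2..k}" "h i = None" for i
    proof -
      have i: "i \<in> {1..k}" using that by auto
      have "pose_source \<P> (x, xg, y, yg, c, cg, u) (jp i) (Uniform i) = Some (p i) \<or>
          pose_source \<P> (x, xg, y, yg, c, cg, u) (jp i) (Goal i) = Some (p i)"
        using that goal_nonempty[of i] by (auto simp: p_def)
      then show ?thesis using i unfolding jp_def[symmetric] pose_samples_def samples_def by blast
    qed
    show "g i \<in> grasp_samples D \<P> (x, xg, y, yg, c, cg, u) j k"
      if "i \<in> {2..k}" "h i = Some j" for i j
    proof -
      have i: "i \<in> {1..k}" "jg i = j" using that by (auto simp: jg_def)
      have "grasp_source D \<P> (x, xg, y, yg, c, cg, u) j (Uniform i) = Some (g i) \<or>
          grasp_source D \<P> (x, xg, y, yg, c, cg, u) j (Goal i) = Some (g i)"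
        using gg_held[of i] i(2) by (auto simp: g_def)
      then show ?thesis using i(1) unfolding grasp_samples_def samples_def by blast
    qed
  qed
  show False
  proof (rule not_AE_unsolved_if_params[OF valid k _ seq goal multi _ 5])
    show "?\<omega> 1 = init_mode \<P>" by simp
    fix i assume i: "i \<in> {1..<k}"
    obtain j p' g' where sw: "switch (?\<omega> i) (?\<omega> (Suc i)) j p' g'"
      "switch_transform (?\<omega> i) (?\<omega> (Suc i)) = ik_target p' g'"
      by (rule param_modes_switch[where h = h and g = g and p = p and k = k, OF dom h1 grasps seq i])
    have "p' \<in> pose_samples \<P> (x, xg, y, yg, c, cg, u) j k \<and>
        g' \<in> grasp_samples D \<P> (x, xg, y, yg, c, cg, u) j k"
      for c cg and u :: "nat \<times> 'o \<times> source \<times> source \<Rightarrow> 'u"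
    proof -
      have i': "i \<in> {1..k}" "Suc i \<in> {1..k}" using i by auto
      show ?thesis
        using switch_cases[OF sw(1)] samples[OF i'(1), of c cg u] samples[OF i'(2), of c cg u] by blast
    qed
    with sw show "\<exists>j p g. switch (?\<omega> i) (?\<omega> (Suc i)) j p g \<and>
      switch_transform (?\<omega> i) (?\<omega> (Suc i)) = ik_target p g \<and>
      (\<forall>c cg (u :: nat \<times> 'o \<times> source \<times> source \<Rightarrow> 'u). p \<in> pose_samples \<P> (x, xg, y, yg, c, cg, u) j k \<and>
        g \<in> grasp_samples D \<P> (x, xg, y, yg, c, cg, u) j k)"
      by blast
  qed
qed

section \<open>The runtime\<close>

text \<open>If \<open>L\<close> is the first successful iteration, the single term at index
  \<open>L - 1\<close> already dominates the square. The series is linear in the indicators of being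
  unsolved, so its expectation involves only their probabilities. The term at 0 always counts,
  because success is tested from iteration 1 on.\<close>

lemma runtime_square_le:
  assumes K: "K > 0" and bound: "\<And>n. n \<ge> 1 \<Longrightarrow> real (elapsed D \<P> search_time w n) \<le> K * real n ^ d"
    and solved: "\<exists>n\<ge>1. solved D \<P> S w n"
  shows "runtime D \<P> S search_time w * runtime D \<P> S search_time w \<le>
    (\<Sum>n. ennreal ((K * real (Suc n) ^ d)\<^sup>2) * of_bool (n = 0 \<or> \<not> solved D \<P> S w n))"
proof -
  define f :: "nat \<Rightarrow> ennreal" where
    "f n = ennreal ((K * real (Suc n) ^ d)\<^sup>2) * of_bool (n = 0 \<or> \<not> solved D \<P> S w n)" for n
  define L where "L = (LEAST n. 1 \<le> n \<and> solved D \<P> S w n)"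
  have L: "1 \<le> L" using LeastI_ex[OF solved] by (simp add: L_def)
  have "\<not> (1 \<le> L - 1 \<and> solved D \<P> S w (L - 1))"
    by (rule not_less_Least) (use L in \<open>simp add: L_def[symmetric] del: One_nat_def\<close>)
  then have first: "L - 1 = 0 \<or> \<not> solved D \<P> S w (L - 1)" by auto
  define e where "e = real (elapsed D \<P> search_time w L)"
  have e: "0 \<le> e" "e \<le> K * real (Suc (L - 1)) ^ d"
    using bound[OF L] L by (auto simp: e_def)
  have "runtime D \<P> S search_time w = ennreal e"
    using solved by (simp add: runtime_def L_def e_def ennreal_of_nat_eq_real_of_nat)
  then have "runtime D \<P> S search_time w * runtime D \<P> S search_time w = ennreal (e\<^sup>2)"
    using e by (simp add: power2_eq_square ennreal_mult)
  also have "\<dots> \<le> f (L - 1)"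
    using e first by (simp add: f_def power_mono ennreal_leI del: of_nat_Suc)
  also have "\<dots> \<le> suminf f"
    using sum_le_suminf[of f "{L - 1}"] by simp
  finally show ?thesis unfolding f_def .
qed

end

theorem corollary1:
  fixes D :: "('c::euclidean_space, 'o::finite, 'w::finite) ppm_domain"
    and \<P> :: "('c, 'o, 'w) ppm_problem"
    and S :: "('c, 'o, 'w, 'u) sampling"
    and search_time :: "('c, 'o, 'w, 'u) draws \<Rightarrow> nat \<Rightarrow> nat"
  assumes "ppm_domain D"
    and "ppm_problem D \<P>"
    and "valid_sampling D \<P> S"
    and "robustly_feasible D \<P> S"
    and "dijkstra_cost D \<P> S search_time"
    and "measurable_run D \<P> S search_time"
  shows "mean (draw_space D \<P> S) (runtime D \<P> S search_time) < \<infinity> \<and>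
         var (draw_space D \<P> S) (runtime D \<P> S search_time) < \<infinity>"
proof -
  let ?M = "draw_space D \<P> S" and ?T = "runtime D \<P> S search_time"
  interpret prob_space ?M by (rule prob_space_draw_space) fact
  define U where "U n = {w \<in> space ?M. \<not> solved D \<P> S w n}" for n
  have solved_sets: "{w \<in> space ?M. solved D \<P> S w n} \<in> sets ?M" if "n \<ge> 1" for n
    using assms(6) that by (simp add: measurable_run_def)
  have T: "?T \<in> borel_measurable ?M"
    using assms(6) by (simp add: measurable_run_def)
  have U: "U n \<in> sets ?M" if "n \<ge> 1" for n
  proof -
    have "U n = space ?M - {w \<in> space ?M. solved D \<P> S w n}" by (auto simp: U_def)
    then show ?thesis using solved_sets[OF that] by simp
  qed
  have sub: "prob (U (N + n)) \<le> prob (U N) * prob (U n)" if "N \<ge> 1" "n \<ge> 1" for N n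
    using unsolved_submultiplicative[OF assms(3) solved_sets that]
    unfolding U_def[symmetric] by (simp add: emeasure_eq_measure ennreal_mult[symmetric])
  have "\<exists>N\<ge>1. prob (U N) < 1"
  proof (rule ccontr)
    assume "\<not> (\<exists>N\<ge>1. prob (U N) < 1)"
    then have "prob (U n) = 1" if "n \<ge> 1" for n
      using prob_le_1[of "U n"] that by (metis less_eq_real_def)
    then have "AE w in ?M. n \<ge> 1 \<longrightarrow> \<not> solved D \<P> S w n" for n
      using prob_eq_1[OF U[of n]] by (cases "n \<ge> 1") (auto simp: U_def)
    then have "AE w in ?M. \<forall>n\<ge>1. \<not> solved D \<P> S w n"
      by (simp add: AE_all_countable)
    then show False using not_AE_unsolved[OF assms(1,3,4)] by blast
  qed
  then obtain N where N: "N \<ge> 1" "prob (U N) < 1" by blast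
  obtain C \<rho> where \<rho>: "0 < \<rho>" "\<rho> < 1" and decay: "\<And>n. n \<ge> 1 \<Longrightarrow> prob (U n) \<le> C * \<rho> ^ n"
    by (rule submultiplicative_geometric[where u = "\<lambda>n. prob (U n)", OF _ _ sub N]) auto
  obtain K d where K: "K > 0" and cost: "\<And>w n. w \<in> space ?M \<Longrightarrow> n \<ge> 1 \<Longrightarrow>
      real (elapsed D \<P> search_time w n) \<le> K * real n ^ d"
    using elapsed_poly_bound[OF assms(5)] by blast
  define V where "V n = (if n = 0 then space ?M else U n)" for n
  have V: "V n \<in> sets ?M" for n using U by (simp add: V_def)
  \<comment> \<open>\<open>V 0\<close> is the whole space, of probability 1, so the constant must be
    at least 1 to cover \<open>n = 0\<close>.\<close>
  define B where "B = max C 1"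
  have V_decay: "prob (V n) \<le> B * \<rho> ^ n" for n
  proof (cases "n = 0")
    case True
    then show ?thesis by (simp add: V_def B_def prob_space)
  next
    case False
    have "C * \<rho> ^ n \<le> B * \<rho> ^ n" using \<rho> by (intro mult_right_mono) (auto simp: B_def)
    then show ?thesis using decay[of n] False by (simp add: V_def)
  qed
  define c where "c n = (K * real (Suc n) ^ d)\<^sup>2" for n
  \<comment> \<open>The cost bound at iteration \<open>n + 1\<close> meets the probability of being
    unsolved after \<open>n\<close>; this offset produces the factor
    \<open>1 / \<rho>\<close>.\<close>
  have "summable (\<lambda>n. real (Suc n) ^ (2 * d) * \<rho> ^ Suc n)"
    by (rule iffD2[OF summable_Suc_iff[of "\<lambda>n. real n ^ (2 * d) * \<rho> ^ n"]])
      (rule summable_power_times_geometric[OF \<rho>])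
  then have "summable (\<lambda>n. K\<^sup>2 * B / \<rho> * (real (Suc n) ^ (2 * d) * \<rho> ^ Suc n))"
    by (rule summable_mult)
  then have sums: "summable (\<lambda>n. c n * prob (V n))"
  proof (rule summable_comparison_test')
    fix n :: nat
    have "norm (c n * prob (V n)) \<le> c n * (B * \<rho> ^ n)"
      using V_decay[of n] by (simp add: c_def mult_left_mono)
    also have "\<dots> = K\<^sup>2 * B / \<rho> * (real (Suc n) ^ (2 * d) * \<rho> ^ Suc n)"
      using \<rho> by (simp add: c_def power_mult_distrib power_mult[symmetric] mult.commute[of d] del: of_nat_Suc)
    finally show "norm (c n * prob (V n)) \<le> K\<^sup>2 * B / \<rho> * (real (Suc n) ^ (2 * d) * \<rho> ^ Suc n)" .
  qed
  \<comment> \<open>Almost sure success is established separately, by the first Borel-Cantelli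
    lemma: the runtime is infinite on unsolved runs, and its square is bounded only where a solved
    iteration exists.\<close>
  have "summable (\<lambda>n. C * \<rho> ^ Suc n)"
    using \<rho> by (intro summable_mult iffD2[OF summable_Suc_iff[of "\<lambda>n. \<rho> ^ n"]] summable_geometric) simp
  then have "summable (\<lambda>n. prob (U (Suc n)))"
    by (rule summable_comparison_test'[where N = 0]) (use decay[of "Suc n" for n] in simp)
  then have "AE w in ?M. eventually (\<lambda>n. w \<in> space ?M - U (Suc n)) sequentially"
    by (intro borel_cantelli_AE1) (auto intro!: U simp: emeasure_eq_measure)
  then have solved: "AE w in ?M. \<exists>n\<ge>1. solved D \<P> S w n"
  proof (rule AE_mp, intro AE_I2 impI)
    fix w assume "eventually (\<lambda>n. w \<in> space ?M - U (Suc n)) sequentially"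
    then obtain n where "w \<in> space ?M - U (Suc n)"
      by (meson eventually_sequentially order_refl)
    then show "\<exists>n\<ge>1. solved D \<P> S w n"
      by (intro exI[of _ "Suc n"]) (auto simp: U_def)
  qed
  have "(\<integral>\<^sup>+ w. ?T w * ?T w \<partial>?M) \<le> (\<integral>\<^sup>+ w. (\<Sum>n. ennreal (c n) * indicator (V n) w) \<partial>?M)"
  proof (rule nn_integral_mono_AE, use solved in \<open>rule AE_mp\<close>, intro AE_I2 impI)
    fix w assume w: "w \<in> space ?M" and "\<exists>n\<ge>1. solved D \<P> S w n"
    have "of_bool (n = 0 \<or> \<not> solved D \<P> S w n) = (indicator (V n) w :: ennreal)" for n
      using w by (auto simp: V_def U_def)
    with runtime_square_le[OF K cost[OF w] \<open>\<exists>n\<ge>1. solved D \<P> S w n\<close>]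
    show "?T w * ?T w \<le> (\<Sum>n. ennreal (c n) * indicator (V n) w)"
      unfolding c_def by simp
  qed
  also have "\<dots> = (\<Sum>n. \<integral>\<^sup>+ w. ennreal (c n) * indicator (V n) w \<partial>?M)"
    by (rule nn_integral_suminf) (use V in measurable)
  also have "\<dots> = (\<Sum>n. ennreal (c n * prob (V n)))"
    using V by (simp add: nn_integral_cmult_indicator emeasure_eq_measure ennreal_mult c_def)
  also have "\<dots> < \<infinity>"
  proof -
    have "0 \<le> c n * prob (V n)" for n by (simp add: c_def)
    from ennreal_suminf_neq_top[OF sums this] show ?thesis by (simp add: less_top[symmetric])
  qed
  finally show ?thesis
    by (intro mean_var_finite T) (rule prob_space_axioms)
qed

end
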